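(* The sequence $\mathcal Y=\{\Bbbk Y_n\}_{n\ge1}$ is a non-symmetric operad under the structure maps $$F_s\circ_iF_t:=F_{B_i(s,t)}\qquad(s\in Y_n,\ t\in Y_m,\ 1\le i\le n).$$ Moreover, the map $\Lambda:\mathcal A\to\mathcal Y$, $\Lambda(F_\sigma):=F_{\lambda(\sigma)}$, is a surjective morphism of non-symmetric operads.
   Context: $\Bbbk$ is a commutative ring; "space" means $\Bbbk$-module. $[n]=\{1,\dots,n\}$. A non-symmetric (unital) operad is a sequence of spaces $\{\mathcal P_n\}_{n\ge1}$ with linear maps $\circ_i:\mathcal P_n\otimes\mathcal P_m\to\mathcal P_{n+m-1}$ ($n,m\ge1$, $1\le i\le n$) and an element $1\in\mathcal P_1$ such that for $x\in\mathcal P_n,y\in\mathcal P_m,z\in\mathcal P_l$: $(x\circ_iy)\circ_{j+m-1}z=(x\circ_jz)\circ_iy$ if $1\le i<j\le n$; $(x\circ_iy)\circ_{i+j-1}z=x\circ_i(y\circ_jz)$ if $1\le i\le n$, $1\le j\le m$; $x\circ_i1=x$; $1\circ_1x=x$. A morphism is a sequence of linear maps preserving all $\circ_i$ and the unit. Operad $\mathcal A$. $\mathcal A_n:=\Bbbk S_n$ with basis $\{F_\sigma\}$ and $F_\sigma\circ_iF_\tau=F_{B_i(\sigma,\tau)}$, unit $F_{(1)}$, where for $\sigma\in S_n,\tau\in S_m$, $B_i(\sigma,\tau):=(a_1,\dots,a_{i-1},b_1,\dots,b_m,a_{i+1},\dots,a_n)$ with $a_j=\sigma_j$ if $\sigma_j<\sigma_i$,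 $a_j=\sigma_j+m-1$ if $\sigma_j>\sigma_i$, $b_k=\tau_k+\sigma_i-1$. Trees. $Y_n$ is the set of rooted planar binary trees with $n$ internal nodes ($n+1$ leaves); $|t|=n$ for $t\in Y_n$; $1_0$ is the unique element of $Y_0$. The grafting $s\vee t\in Y_{|s|+|t|+1}$ joins a new root to the roots of $s$ (left) and $t$ (right); each $t\in Y_n$, $n\ge1$, is uniquely $t=t_l\vee t_r$. $s\backslash t$ is obtained by gluing the root of $t$ to the rightmost branch of $s$ (so $1_0\backslash t=t$, $s\backslash t=s_l\vee(s_r\backslash t)$), and $s/t$ by gluing the root of $s$ to the leftmost branch of $t$ (so $s/1_0=s$, $s/t=(s/t_l)\vee t_r$). For $s\in Y_n$, $t\in Y_m$, $1\le i\le n$, put $j:=|s_l|+1$ and define $B_i(s,t)\in Y_{n+m-1}$ recursively: $B_i(s,t)=s_l\vee B_{i-j}(s_r,t)$ if $j<i$; $B_i(s,t)=(s_l/t_l)\vee(t_r\backslash s_r)$ if $j=i$; $B_i(s,t)=B_i(s_l,t)\vee s_r$ if $j>i$. $\Bbbk Y_n$ has basis $\{F_t\}_{t\in Y_n}$; the unit of $\mathcal Y$ is $F_{\mathrm Y}$ for the unique $\mathrm Y\in Y_1$. The map $\lambda:S_n\to Y_n$. $\lambda$ of the empty permutation is $1_0$; for $\sigma\in S_n$, $n\ge1$, with $j:=\sigma^{-1}(n)$, $\lambda(\sigma):=\lambda(\mathrm{st}(\sigma_1,\dots,\sigma_{j-1}))\vee\lambda(\mathrm{st}(\sigma_{j+1},\dots,\sigma_n))$,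 where $\mathrm{st}(a)$ is the permutation with the same relative order as the sequence $a$ of distinct integers. *)

theory Defs
  imports "HOL-Algebra.Module" "HOL-Combinatorics.Multiset_Permutations"
begin

section \<open>Linear and bilinear maps\<close>

definition linear_maps ::
  "('r, 'm) ring_scheme \<Rightarrow> ('r, 'a, 'p) module_scheme \<Rightarrow> ('r, 'b, 'q) module_scheme \<Rightarrow> ('a \<Rightarrow> 'b) set"
  where "linear_maps R M N =
    {h \<in> carrier M \<rightarrow> carrier N.
      (\<forall>x\<in>carrier M. \<forall>y\<in>carrier M. h (x \<oplus>\<^bsub>M\<^esub> y) = h x \<oplus>\<^bsub>N\<^esub> h y) \<and>
      (\<forall>a\<in>carrier R. \<forall>x\<in>carrier M. h (a \<odot>\<^bsub>M\<^esub> x) = a \<odot>\<^bsub>N\<^esub> h x)}"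

definition bilinear_maps ::
  "('r, 'm) ring_scheme \<Rightarrow> ('r, 'a, 'p) module_scheme \<Rightarrow> ('r, 'b, 'q) module_scheme \<Rightarrow>
   ('r, 'c, 's) module_scheme \<Rightarrow> ('a \<Rightarrow> 'b \<Rightarrow> 'c) set"
  where "bilinear_maps R M N Q =
    {f. (\<forall>x\<in>carrier M. f x \<in> linear_maps R N Q) \<and>
        (\<forall>y\<in>carrier N. (\<lambda>x. f x y) \<in> linear_maps R M Q)}"

section \<open>Non-symmetric operads\<close>

text \<open>
  \<open>comp n m i x y\<close> is \<open>x \<circ>\<^sub>i y\<close> for \<open>x\<close> of arity \<open>n\<close> and \<open>y\<close> of arity \<open>m\<close>.  A linear map out of
  \<open>P n \<otimes> P m\<close> is given as a bilinear map on \<open>P n\<close> and \<open>P m\<close>.  The components start in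
  arity 1; nothing is required of \<open>P 0\<close>.
\<close>

locale ns_operad = R?: cring R
  for R :: "('r, 'm) ring_scheme" (structure)
    and P :: "nat \<Rightarrow> ('r, 'a, 'p) module_scheme"
    and comp :: "nat \<Rightarrow> nat \<Rightarrow> nat \<Rightarrow> 'a \<Rightarrow> 'a \<Rightarrow> 'a"
    and unit :: 'a +
  assumes arity_module: "n \<ge> 1 \<Longrightarrow> Module.module R (P n)"
    and comp_bilinear:
      "\<lbrakk>n \<ge> 1; m \<ge> 1; 1 \<le> i; i \<le> n\<rbrakk> \<Longrightarrow> comp n m i \<in> bilinear_maps R (P n) (P m) (P (n + m - 1))"
    and unit_closed: "unit \<in> carrier (P 1)"
    and comp_parallel:
      "\<lbrakk>n \<ge> 1; m \<ge> 1; l \<ge> 1; x \<in> carrier (P n); y \<in> carrier (P m); z \<in> carrier (P l);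
        1 \<le> i; i < j; j \<le> n\<rbrakk> \<Longrightarrow>
       comp (n + m - 1) l (j + m - 1) (comp n m i x y) z =
       comp (n + l - 1) m i (comp n l j x z) y"
    and comp_sequential:
      "\<lbrakk>n \<ge> 1; m \<ge> 1; l \<ge> 1; x \<in> carrier (P n); y \<in> carrier (P m); z \<in> carrier (P l);
        1 \<le> i; i \<le> n; 1 \<le> j; j \<le> m\<rbrakk> \<Longrightarrow>
       comp (n + m - 1) l (i + j - 1) (comp n m i x y) z =
       comp n (m + l - 1) i x (comp m l j y z)"
    and comp_unit_right: "\<lbrakk>n \<ge> 1; x \<in> carrier (P n); 1 \<le> i; i \<le> n\<rbrakk> \<Longrightarrow> comp n 1 i x unit = x"
    and comp_unit_left: "\<lbrakk>n \<ge> 1; x \<in> carrier (P n)\<rbrakk> \<Longrightarrow> comp 1 n 1 unit x = x"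

locale ns_operad_morphism =
  A: ns_operad R P compP unitP + B: ns_operad R Q compQ unitQ
  for R :: "('r, 'm) ring_scheme" (structure)
    and P :: "nat \<Rightarrow> ('r, 'a, 'p) module_scheme"
    and compP :: "nat \<Rightarrow> nat \<Rightarrow> nat \<Rightarrow> 'a \<Rightarrow> 'a \<Rightarrow> 'a" and unitP :: 'a
    and Q :: "nat \<Rightarrow> ('r, 'b, 'q) module_scheme"
    and compQ :: "nat \<Rightarrow> nat \<Rightarrow> nat \<Rightarrow> 'b \<Rightarrow> 'b \<Rightarrow> 'b" and unitQ :: 'b +
  fixes h :: "nat \<Rightarrow> 'a \<Rightarrow> 'b"
  assumes morphism_linear: "n \<ge> 1 \<Longrightarrow> h n \<in> linear_maps R (P n) (Q n)"
    and morphism_comp: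
      "\<lbrakk>n \<ge> 1; m \<ge> 1; 1 \<le> i; i \<le> n; x \<in> carrier (P n); y \<in> carrier (P m)\<rbrakk> \<Longrightarrow>
       h (n + m - 1) (compP n m i x y) = compQ n m i (h n x) (h m y)"
    and morphism_unit: "h 1 unitP = unitQ"

section \<open>Free modules and extension from the basis\<close>

text \<open>
  The free module on a set \<open>X\<close> of basis indices consists of the finitely supported functions
  vanishing outside \<open>X\<close>.  The \<open>mult\<close> and \<open>one\<close> fields that the module record inherits from
  rings play no role.
\<close>

definition free_module :: "('r, 'm) ring_scheme \<Rightarrow> 'x set \<Rightarrow> ('r, 'x \<Rightarrow> 'r) module" where
  "free_module R X =
    \<lparr>carrier = {f. (\<forall>x. f x \<in> carrier R) \<and> finite {x. f x \<noteq> \<zero>\<^bsub>R\<^esub>} \<and> (\<forall>x. x \<notin> X \<longrightarrow> f x = \<zero>\<^bsub>R\<^esub>)},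
     monoid.mult = undefined, one = undefined,
     zero = (\<lambda>x. \<zero>\<^bsub>R\<^esub>), add = (\<lambda>f g x. f x \<oplus>\<^bsub>R\<^esub> g x),
     smult = (\<lambda>a f x. a \<otimes>\<^bsub>R\<^esub> f x)\<rparr>"

definition basis_vec :: "('r, 'm) ring_scheme \<Rightarrow> 'x \<Rightarrow> 'x \<Rightarrow> 'r" where
  "basis_vec R x = (\<lambda>y. if y = x then \<one>\<^bsub>R\<^esub> else \<zero>\<^bsub>R\<^esub>)"

text \<open>
  The linear extension of \<open>F\<^sub>x \<mapsto> F\<^bsub>\<phi> x\<^esub>\<close> and the bilinear extension of
  \<open>(F\<^sub>x, F\<^sub>y) \<mapsto> F\<^bsub>\<beta> x y\<^esub>\<close>, given by their coefficients at each basis vector.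
\<close>

definition linear_ext ::
  "('r, 'm) ring_scheme \<Rightarrow> ('x \<Rightarrow> 'y) \<Rightarrow> ('x \<Rightarrow> 'r) \<Rightarrow> 'y \<Rightarrow> 'r" where
  "linear_ext R \<phi> f = (\<lambda>v. \<Oplus>\<^bsub>R\<^esub>x\<in>{x. f x \<noteq> \<zero>\<^bsub>R\<^esub> \<and> \<phi> x = v}. f x)"

definition bilinear_ext ::
  "('r, 'm) ring_scheme \<Rightarrow> ('x \<Rightarrow> 'y \<Rightarrow> 'z) \<Rightarrow> ('x \<Rightarrow> 'r) \<Rightarrow> ('y \<Rightarrow> 'r) \<Rightarrow> 'z \<Rightarrow> 'r" where
  "bilinear_ext R \<beta> f g =
    (\<lambda>w. \<Oplus>\<^bsub>R\<^esub>p\<in>{(x, y). f x \<noteq> \<zero>\<^bsub>R\<^esub> \<and> g y \<noteq> \<zero>\<^bsub>R\<^esub> \<and> \<beta> x y = w}. f (fst p) \<otimes>\<^bsub>R\<^esub> g (snd p))"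

section \<open>The operad of permutations\<close>

text \<open>Permutations are written in one-line notation; \<open>\<sigma>\<^sub>i\<close> is \<open>\<sigma> ! (i - 1)\<close>.\<close>

definition perms :: "nat \<Rightarrow> nat list set" where
  "perms n = permutations_of_set {1..n}"

definition perm_insert :: "nat \<Rightarrow> nat list \<Rightarrow> nat list \<Rightarrow> nat list" where
  "perm_insert i \<sigma> \<tau> =
    (let m = length \<tau>; p = \<sigma> ! (i - 1);
         a = (\<lambda>q. if q < p then q else q + m - 1)
     in map a (take (i - 1) \<sigma>) @ map (\<lambda>q. q + p - 1) \<tau> @ map a (drop i \<sigma>))"

definition A_op :: "('r, 'm) ring_scheme \<Rightarrow> nat \<Rightarrow> ('r, nat list \<Rightarrow> 'r) module" where
  "A_op R n = free_module R (perms n)"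

definition A_comp ::
  "('r, 'm) ring_scheme \<Rightarrow> nat \<Rightarrow> nat \<Rightarrow> nat \<Rightarrow> (nat list \<Rightarrow> 'r) \<Rightarrow> (nat list \<Rightarrow> 'r) \<Rightarrow> nat list \<Rightarrow> 'r" where
  "A_comp R n m i = bilinear_ext R (perm_insert i)"

definition A_unit :: "('r, 'm) ring_scheme \<Rightarrow> nat list \<Rightarrow> 'r" where
  "A_unit R = basis_vec R [1]"

section \<open>Planar binary trees\<close>

text \<open>
  \<open>Leaf\<close> is the tree without internal nodes and \<open>Graft s t\<close> is the grafting of \<open>s\<close> (left) and
  \<open>t\<close> (right).  The datatype's \<open>size\<close> counts the \<open>Graft\<close> constructors, that is, the internal nodes.
\<close>

datatype pbtree = Leaf | Graft (left: pbtree) (right: pbtree)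
  where "left Leaf = Leaf" | "right Leaf = Leaf"

definition trees :: "nat \<Rightarrow> pbtree set" where
  "trees n = {t. size t = n}"

text \<open>\<open>under s t\<close> and \<open>over s t\<close> are the trees usually written with a backslash and a slash.\<close>

fun under :: "pbtree \<Rightarrow> pbtree \<Rightarrow> pbtree" where
  "under Leaf t = t"
| "under (Graft l r) t = Graft l (under r t)"

fun over :: "pbtree \<Rightarrow> pbtree \<Rightarrow> pbtree" where
  "over s Leaf = s"
| "over s (Graft l r) = Graft (over s l) r"

text \<open>Only used for \<open>1 \<le> i \<le> size s\<close> and \<open>t \<noteq> Leaf\<close>; the first equation is a dummy value.\<close>

fun tree_insert :: "nat \<Rightarrow> pbtree \<Rightarrow> pbtree \<Rightarrow> pbtree" where
  "tree_insert i Leaf t = Leaf"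
| "tree_insert i (Graft l r) t =
    (let j = size l + 1 in
     if j < i then Graft l (tree_insert (i - j) r t)
     else if j = i then Graft (over l (left t)) (under (right t) r)
     else Graft (tree_insert i l t) r)"

definition Y_op :: "('r, 'm) ring_scheme \<Rightarrow> nat \<Rightarrow> ('r, pbtree \<Rightarrow> 'r) module" where
  "Y_op R n = free_module R (trees n)"

definition Y_comp ::
  "('r, 'm) ring_scheme \<Rightarrow> nat \<Rightarrow> nat \<Rightarrow> nat \<Rightarrow> (pbtree \<Rightarrow> 'r) \<Rightarrow> (pbtree \<Rightarrow> 'r) \<Rightarrow> pbtree \<Rightarrow> 'r" where
  "Y_comp R n m i = bilinear_ext R (tree_insert i)"

definition Y_unit :: "('r, 'm) ring_scheme \<Rightarrow> pbtree \<Rightarrow> 'r" where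
  "Y_unit R = basis_vec R (Graft Leaf Leaf)"

section \<open>From permutations to trees\<close>

text \<open>Standardization: each entry is replaced by its rank among the entries.\<close>

definition std :: "nat list \<Rightarrow> nat list" where
  "std xs = map (\<lambda>x. card {y \<in> set xs. y \<le> x}) xs"

text \<open>
  For \<open>\<sigma> \<in> perms n\<close> with \<open>n \<ge> 1\<close> the largest entry is \<open>n = length \<sigma>\<close>, and \<open>j\<close> is its (1-based)
  position.  The test \<open>length \<sigma> \<in> set \<sigma>\<close> fails for the empty permutation, and otherwise only
  for lists that are not permutations.
\<close>

function perm_tree :: "nat list \<Rightarrow> pbtree" where
  "perm_tree \<sigma> =
    (if length \<sigma> \<in> set \<sigma> then
       let j = length (takeWhile (\<lambda>x. x \<noteq> length \<sigma>) \<sigma>) + 1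
       in Graft (perm_tree (std (take (j - 1) \<sigma>))) (perm_tree (std (drop j \<sigma>)))
     else Leaf)"
  by pat_completeness auto
termination
proof (relation "measure length")
  fix \<sigma> :: "nat list" and j
  assume mem: "length \<sigma> \<in> set \<sigma>"
    and j: "j = length (takeWhile (\<lambda>x. x \<noteq> length \<sigma>) \<sigma>) + 1"
  have "dropWhile (\<lambda>x. x \<noteq> length \<sigma>) \<sigma> \<noteq> []"
    using mem by (simp add: dropWhile_eq_Nil_conv)
  moreover have "length \<sigma> = length (takeWhile (\<lambda>x. x \<noteq> length \<sigma>) \<sigma>)
      + length (dropWhile (\<lambda>x. x \<noteq> length \<sigma>) \<sigma>)"
    by (subst length_append [symmetric]) simp
  ultimately have lt: "length (takeWhile (\<lambda>x. x \<noteq> length \<sigma>) \<sigma>) < length \<sigma>"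
    by (metis length_greater_0_conv less_add_same_cancel1)
  show "(std (take (j - 1) \<sigma>), \<sigma>) \<in> measure length"
    using lt by (simp add: std_def j)
  show "(std (drop j \<sigma>), \<sigma>) \<in> measure length"
    using lt by (simp add: std_def j)
qed simp

declare perm_tree.simps [simp del]

definition Lambda :: "('r, 'm) ring_scheme \<Rightarrow> nat \<Rightarrow> (nat list \<Rightarrow> 'r) \<Rightarrow> pbtree \<Rightarrow> 'r" where
  "Lambda R n = linear_ext R perm_tree"

end

theory Submission
  imports Defs
begin

text \<open>
  Both operads are linearizations of operads of sets: composition sends a pair of basis vectors to a
  basis vector.  The axioms of an operad and of a morphism of operads are identities between multilinear
  maps, so they hold if they hold on basis vectors.  Everything is thereby reduced to statements on the
  insertions \<open>perm_insert\<close> and \<open>tree_insert\<close>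
  (\<open>ns_set_operad.linearization\<close>, \<open>ns_set_operad_morphism.linearization\<close>).

  For permutations the axioms are checked letter by letter.  For trees no associativity law is proved
  directly.  The map \<open>perm_tree\<close> is surjective and commutes with the insertions, so the axioms for
  trees are images of those for permutations (\<open>ns_set_operad.surjective_image\<close>).

  That \<open>perm_tree\<close> commutes with the insertions is the core of the matter
  (\<open>decreasing_tree_insert\<close>).  The tree of a permutation depends only on the relative order of its
  letters: the largest letter is the root, and the words to its left and to its right give the two
  subtrees.  Inserting \<open>\<tau>\<close> at the letter \<open>p\<close> of \<open>\<sigma>\<close> replaces \<open>p\<close> by a copy of \<open>\<tau>\<close> whose letters
  compare with all other letters as \<open>p\<close> did.  As long as the largest letter differs from \<open>p\<close> it remains
  the root, and the insertion descends into the subtree that contains \<open>p\<close>.  Once \<open>p\<close> is the largest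
  letter of a word \<open>u p v\<close>, the root becomes the largest letter of \<open>\<tau> = \<tau>\<^sub>1 N \<tau>\<^sub>2\<close>, with
  \<open>u \<tau>\<^sub>1\<close> on its left and \<open>\<tau>\<^sub>2 v\<close> on its right.  All letters of \<open>u\<close> and \<open>v\<close> being smaller than
  those of \<open>\<tau>\<close>, the trees of these two words are formed by \<open>over\<close> and \<open>under\<close>, which is the
  recursive definition of \<open>tree_insert\<close>.
\<close>

section \<open>Multilinear maps on free modules\<close>

lemma free_module_sel:
  "carrier (free_module R X) =
    {f. (\<forall>x. f x \<in> carrier R) \<and> finite {x. f x \<noteq> \<zero>\<^bsub>R\<^esub>} \<and> (\<forall>x. x \<notin> X \<longrightarrow> f x = \<zero>\<^bsub>R\<^esub>)}"
  "f \<oplus>\<^bsub>free_module R X\<^esub> g = (\<lambda>x. f x \<oplus>\<^bsub>R\<^esub> g x)"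
  "\<zero>\<^bsub>free_module R X\<^esub> = (\<lambda>x. \<zero>\<^bsub>R\<^esub>)"
  "a \<odot>\<^bsub>free_module R X\<^esub> f = (\<lambda>x. a \<otimes>\<^bsub>R\<^esub> f x)"
  by (simp_all add: free_module_def)

lemma (in cring) free_module_add_closed:
  assumes "f \<in> carrier (free_module R X)" "g \<in> carrier (free_module R X)"
  shows "(\<lambda>x. f x \<oplus> g x) \<in> carrier (free_module R X)"
proof -
  have "finite ({x. f x \<noteq> \<zero>} \<union> {x. g x \<noteq> \<zero>})"
    using assms by (simp add: free_module_sel)
  then have "finite {x. f x \<oplus> g x \<noteq> \<zero>}"
    by (rule rev_finite_subset) auto
  then show ?thesis
    using assms by (simp add: free_module_sel)
qed

lemma (in cring) free_module_smult_closed: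
  assumes "a \<in> carrier R" "f \<in> carrier (free_module R X)"
  shows "(\<lambda>x. a \<otimes> f x) \<in> carrier (free_module R X)"
proof -
  have "finite {x. f x \<noteq> \<zero>}"
    using assms by (simp add: free_module_sel)
  then have "finite {x. a \<otimes> f x \<noteq> \<zero>}"
    by (rule rev_finite_subset) (use assms in auto)
  then show ?thesis
    using assms by (simp add: free_module_sel)
qed

lemma (in cring) free_module_module: "Module.module R (free_module R X)"
proof (rule moduleI)
  let ?M = "free_module R X"
  show "cring R" by (rule cring_axioms)
  show "abelian_group ?M"
  proof (rule abelian_groupI)
    fix f assume f: "f \<in> carrier ?M"
    have "{x. \<ominus> f x \<noteq> \<zero>} \<subseteq> {x. f x \<noteq> \<zero>}"
      by auto
    with f have "finite {x. \<ominus> f x \<noteq> \<zero>}"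
      by (simp add: free_module_sel finite_subset)
    with f show "\<exists>g\<in>carrier ?M. g \<oplus>\<^bsub>?M\<^esub> f = \<zero>\<^bsub>?M\<^esub>"
      by (intro bexI[of _ "\<lambda>x. \<ominus> f x"]) (auto simp: free_module_sel l_neg)
  next
    fix f g assume "f \<in> carrier ?M" "g \<in> carrier ?M"
    then show "f \<oplus>\<^bsub>?M\<^esub> g \<in> carrier ?M"
      using free_module_add_closed by (simp add: free_module_sel(2))
  qed (auto simp: free_module_sel a_assoc a_comm a_lcomm)
  fix a f assume "a \<in> carrier R" "f \<in> carrier ?M"
  then show "a \<odot>\<^bsub>?M\<^esub> f \<in> carrier ?M"
    using free_module_smult_closed by (simp add: free_module_sel(4))
qed (auto simp: free_module_sel l_distr r_distr m_assoc)

lemma (in cring) basis_vec_closed: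
  "x \<in> X \<Longrightarrow> basis_vec R x \<in> carrier (free_module R X)"
proof -
  assume "x \<in> X"
  moreover have "finite {y. basis_vec R x y \<noteq> \<zero>}"
    by (rule finite_subset[of _ "{x}"]) (auto simp: basis_vec_def)
  ultimately show ?thesis
    by (auto simp: free_module_sel basis_vec_def)
qed

lemma linear_maps_closed:
  "h \<in> linear_maps R M N \<Longrightarrow> x \<in> carrier M \<Longrightarrow> h x \<in> carrier N"
  by (auto simp: linear_maps_def)

lemma id_linear: "(\<lambda>x. x) \<in> linear_maps R M M"
  by (simp add: linear_maps_def)

lemma linear_maps_comp:
  assumes "h \<in> linear_maps R M N" "k \<in> linear_maps R N Q"
  shows "(\<lambda>x. k (h x)) \<in> linear_maps R M Q"
  using assms unfolding linear_maps_def Pi_def by simp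

text \<open>
  A finitely supported function is a linear combination of basis vectors; the induction removes
  one point of a finite set containing the support at a time.
\<close>

lemma (in cring) linear_maps_basis_eqI:
  assumes h: "h \<in> linear_maps R (free_module R X) N" and k: "k \<in> linear_maps R (free_module R X) N"
    and N: "Module.module R N"
    and basis: "\<And>x. x \<in> X \<Longrightarrow> h (basis_vec R x) = k (basis_vec R x)"
    and f: "f \<in> carrier (free_module R X)"
  shows "h f = k f"
proof -
  interpret N: Module.module R N by (rule N)
  interpret M: Module.module R "free_module R X" by (rule free_module_module)
  have zero: "l \<zero>\<^bsub>free_module R X\<^esub> = \<zero>\<^bsub>N\<^esub>" if l: "l \<in> linear_maps R (free_module R X) N" for l
  proof -
    have "l \<zero>\<^bsub>free_module R X\<^esub> = l (\<zero> \<odot>\<^bsub>free_module R X\<^esub> \<zero>\<^bsub>free_module R X\<^esub>)"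
      by simp
    also have "\<dots> = \<zero> \<odot>\<^bsub>N\<^esub> l \<zero>\<^bsub>free_module R X\<^esub>"
      using l unfolding linear_maps_def by blast
    also have "\<dots> = \<zero>\<^bsub>N\<^esub>"
      using linear_maps_closed[OF l] by simp
    finally show ?thesis .
  qed
  have "finite {x. f x \<noteq> \<zero>}"
    using f by (simp add: free_module_sel)
  moreover have "h f = k f" if "finite S" "{x. f x \<noteq> \<zero>} \<subseteq> S" "f \<in> carrier (free_module R X)" for S f
    using that
  proof (induction S arbitrary: f)
    case empty
    then have "f = \<zero>\<^bsub>free_module R X\<^esub>"
      by (auto simp: free_module_sel)
    then show ?case
      using zero[OF h] zero[OF k] by simp
  next
    case (insert x S)
    define g where "g = f(x := \<zero>)"
    have g: "g \<in> carrier (free_module R X)"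
    proof -
      have "finite {y. g y \<noteq> \<zero>}"
        using insert.prems by (auto simp: g_def free_module_sel elim: rev_finite_subset)
      then show ?thesis
        using insert.prems by (simp add: g_def free_module_sel fun_upd_def)
    qed
    have hg: "h g = k g"
      by (rule insert.IH[OF _ g]) (use insert.prems in \<open>auto simp: g_def\<close>)
    show ?case
    proof (cases "x \<in> X")
      case False
      then have "f = g"
        using insert.prems by (auto simp: g_def free_module_sel)
      then show ?thesis
        using hg by simp
    next
      case True
      let ?b = "basis_vec R x"
      have b: "?b \<in> carrier (free_module R X)"
        using True by (rule basis_vec_closed)
      have fx: "f x \<in> carrier R"
        using insert.prems by (simp add: free_module_sel)
      have f_eq: "f = (f x \<odot>\<^bsub>free_module R X\<^esub> ?b) \<oplus>\<^bsub>free_module R X\<^esub> g"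
        using insert.prems by (auto simp: fun_eq_iff g_def free_module_sel basis_vec_def)
      have expand: "l f = (f x \<odot>\<^bsub>N\<^esub> l ?b) \<oplus>\<^bsub>N\<^esub> l g" if l: "l \<in> linear_maps R (free_module R X) N" for l
      proof -
        have "l f = l (f x \<odot>\<^bsub>free_module R X\<^esub> ?b) \<oplus>\<^bsub>N\<^esub> l g"
          using l g M.smult_closed[OF fx b] f_eq unfolding linear_maps_def by fastforce
        then show ?thesis
          using l fx b unfolding linear_maps_def by simp
      qed
      then show ?thesis
        using expand[OF h] expand[OF k] hg basis[OF True] by simp
    qed
  qed
  ultimately show ?thesis
    using f by blast
qed

lemma bilinear_maps_right: "f \<in> bilinear_maps R M N Q \<Longrightarrow> x \<in> carrier M \<Longrightarrow> f x \<in> linear_maps R N Q"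
  by (simp add: bilinear_maps_def)

lemma bilinear_maps_left:
  "f \<in> bilinear_maps R M N Q \<Longrightarrow> y \<in> carrier N \<Longrightarrow> (\<lambda>x. f x y) \<in> linear_maps R M Q"
  by (simp add: bilinear_maps_def)

lemma bilinear_maps_closed:
  "f \<in> bilinear_maps R M N Q \<Longrightarrow> x \<in> carrier M \<Longrightarrow> y \<in> carrier N \<Longrightarrow> f x y \<in> carrier Q"
  by (blast dest: bilinear_maps_right linear_maps_closed)

lemma bilinear_maps_comp_outer:
  assumes b: "b \<in> bilinear_maps R M N U" and k: "k \<in> linear_maps R U Q"
  shows "(\<lambda>x y. k (b x y)) \<in> bilinear_maps R M N Q"
  using linear_maps_comp[OF bilinear_maps_left[OF b] k] linear_maps_comp[OF bilinear_maps_right[OF b] k]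
  by (simp add: bilinear_maps_def)

lemma bilinear_maps_comp_inner:
  assumes h: "h \<in> linear_maps R M M'" and k: "k \<in> linear_maps R N N'"
    and b: "b \<in> bilinear_maps R M' N' Q"
  shows "(\<lambda>x y. b (h x) (k y)) \<in> bilinear_maps R M N Q"
  using linear_maps_comp[OF h bilinear_maps_left[OF b linear_maps_closed[OF k]]]
    linear_maps_comp[OF k bilinear_maps_right[OF b linear_maps_closed[OF h]]]
  by (simp add: bilinear_maps_def)

lemma (in cring) bilinear_maps_basis_eqI:
  assumes h: "h \<in> bilinear_maps R (free_module R X) (free_module R Y) N"
    and k: "k \<in> bilinear_maps R (free_module R X) (free_module R Y) N"
    and N: "Module.module R N"
    and basis: "\<And>x y. x \<in> X \<Longrightarrow> y \<in> Y \<Longrightarrow>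
      h (basis_vec R x) (basis_vec R y) = k (basis_vec R x) (basis_vec R y)"
    and f: "f \<in> carrier (free_module R X)" and g: "g \<in> carrier (free_module R Y)"
  shows "h f g = k f g"
proof (rule linear_maps_basis_eqI[where h = "\<lambda>f. h f g" and k = "\<lambda>f. k f g", OF _ _ N _ f])
  fix x assume x: "x \<in> X"
  show "h (basis_vec R x) g = k (basis_vec R x) g"
    using basis_vec_closed[OF x] basis[OF x]
    by (intro linear_maps_basis_eqI[OF bilinear_maps_right[OF h] bilinear_maps_right[OF k] N _ g]) auto
qed (rule bilinear_maps_left[OF h g] bilinear_maps_left[OF k g])+

text \<open>
  Both associativity axioms of an operad compare two maps of three arguments.
\<close>

definition trilinear_maps ::
  "('r, 'm) ring_scheme \<Rightarrow> ('r, 'a, 'p) module_scheme \<Rightarrow> ('r, 'b, 'q) module_scheme \<Rightarrow>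
   ('r, 'c, 's) module_scheme \<Rightarrow> ('r, 'd, 't) module_scheme \<Rightarrow> ('a \<Rightarrow> 'b \<Rightarrow> 'c \<Rightarrow> 'd) set"
  where "trilinear_maps R M N L Q =
    {f. (\<forall>x\<in>carrier M. f x \<in> bilinear_maps R N L Q) \<and>
        (\<forall>y\<in>carrier N. \<forall>z\<in>carrier L. (\<lambda>x. f x y z) \<in> linear_maps R M Q)}"

lemma (in cring) trilinear_maps_basis_eqI:
  assumes h: "h \<in> trilinear_maps R (free_module R X) (free_module R Y) (free_module R Z) N"
    and k: "k \<in> trilinear_maps R (free_module R X) (free_module R Y) (free_module R Z) N"
    and N: "Module.module R N"
    and basis: "\<And>x y z. x \<in> X \<Longrightarrow> y \<in> Y \<Longrightarrow> z \<in> Z \<Longrightarrow>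
      h (basis_vec R x) (basis_vec R y) (basis_vec R z) =
      k (basis_vec R x) (basis_vec R y) (basis_vec R z)"
    and f: "f \<in> carrier (free_module R X)" and g: "g \<in> carrier (free_module R Y)"
    and e: "e \<in> carrier (free_module R Z)"
  shows "h f g e = k f g e"
proof (rule linear_maps_basis_eqI[where h = "\<lambda>f. h f g e" and k = "\<lambda>f. k f g e", OF _ _ N _ f])
  fix x assume x: "x \<in> X"
  show "h (basis_vec R x) g e = k (basis_vec R x) g e"
    by (rule bilinear_maps_basis_eqI[OF _ _ N _ g e])
       (use x h k basis basis_vec_closed[OF x] in \<open>auto simp: trilinear_maps_def\<close>)
qed (use h k g e in \<open>auto simp: trilinear_maps_def\<close>)

lemma trilinear_mapsI:
  assumes "\<And>y z. y \<in> carrier N \<Longrightarrow> z \<in> carrier L \<Longrightarrow> (\<lambda>x. f x y z) \<in> linear_maps R M Q"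
    and "\<And>x z. x \<in> carrier M \<Longrightarrow> z \<in> carrier L \<Longrightarrow> (\<lambda>y. f x y z) \<in> linear_maps R N Q"
    and "\<And>x y. x \<in> carrier M \<Longrightarrow> y \<in> carrier N \<Longrightarrow> f x y \<in> linear_maps R L Q"
  shows "f \<in> trilinear_maps R M N L Q"
  using assms by (simp add: trilinear_maps_def bilinear_maps_def)

lemma trilinear_maps_comp_left:
  assumes b: "b \<in> bilinear_maps R M N U" and c: "c \<in> bilinear_maps R U L Q"
  shows "(\<lambda>x y z. c (b x y) z) \<in> trilinear_maps R M N L Q"
proof (rule trilinear_mapsI)
  show "(\<lambda>x. c (b x y) z) \<in> linear_maps R M Q" if "y \<in> carrier N" "z \<in> carrier L" for y z
    by (rule linear_maps_comp[OF bilinear_maps_left[OF b that(1)] bilinear_maps_left[OF c that(2)]])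
  show "(\<lambda>y. c (b x y) z) \<in> linear_maps R N Q" if "x \<in> carrier M" "z \<in> carrier L" for x z
    by (rule linear_maps_comp[OF bilinear_maps_right[OF b that(1)] bilinear_maps_left[OF c that(2)]])
  show "c (b x y) \<in> linear_maps R L Q" if "x \<in> carrier M" "y \<in> carrier N" for x y
    by (rule bilinear_maps_right[OF c bilinear_maps_closed[OF b that]])
qed

lemma trilinear_maps_comp_right:
  assumes b: "b \<in> bilinear_maps R N L U" and c: "c \<in> bilinear_maps R M U Q"
  shows "(\<lambda>x y z. c x (b y z)) \<in> trilinear_maps R M N L Q"
proof (rule trilinear_mapsI)
  show "(\<lambda>x. c x (b y z)) \<in> linear_maps R M Q" if "y \<in> carrier N" "z \<in> carrier L" for y z
    by (rule bilinear_maps_left[OF c bilinear_maps_closed[OF b that]])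
  show "(\<lambda>y. c x (b y z)) \<in> linear_maps R N Q" if "x \<in> carrier M" "z \<in> carrier L" for x z
    by (rule linear_maps_comp[OF bilinear_maps_left[OF b that(2)] bilinear_maps_right[OF c that(1)]])
  show "(\<lambda>z. c x (b y z)) \<in> linear_maps R L Q" if "x \<in> carrier M" "y \<in> carrier N" for x y
    by (rule linear_maps_comp[OF bilinear_maps_right[OF b that(2)] bilinear_maps_right[OF c that(1)]])
qed

lemma trilinear_maps_swap:
  assumes "f \<in> trilinear_maps R M L N Q"
  shows "(\<lambda>x y z. f x z y) \<in> trilinear_maps R M N L Q"
  using assms by (intro trilinear_mapsI) (auto simp: trilinear_maps_def bilinear_maps_def)

section \<open>Linear and bilinear extension\<close>

text \<open>
  Two functions have different supports, and so their sum is only computed termwise over a common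
  finite set of indices.
\<close>

lemma (in cring) linear_ext_superset:
  assumes "\<And>x. f x \<in> carrier R" "finite S" "{x. f x \<noteq> \<zero>} \<subseteq> S"
  shows "linear_ext R \<phi> f v = (\<Oplus>x\<in>S. if \<phi> x = v then f x else \<zero>)"
  unfolding linear_ext_def
  by (rule add.finprod_mono_neutral_cong_left) (use assms in auto)

lemma (in cring) linear_ext_linear:
  assumes \<phi>: "\<And>x. x \<in> X \<Longrightarrow> \<phi> x \<in> Y"
  shows "linear_ext R \<phi> \<in> linear_maps R (free_module R X) (free_module R Y)"
proof -
  have closed: "linear_ext R \<phi> f \<in> carrier (free_module R Y)"
    if f: "f \<in> carrier (free_module R X)" for f
  proof -
    have fc: "f x \<in> carrier R" for x
      using f by (simp add: free_module_sel)
    have fX: "x \<in> X" if "f x \<noteq> \<zero>" for x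
      using f that by (auto simp: free_module_sel)
    have supp: "v \<in> \<phi> ` {x. f x \<noteq> \<zero>}" if "linear_ext R \<phi> f v \<noteq> \<zero>" for v
    proof (rule ccontr)
      assume "v \<notin> \<phi> ` {x. f x \<noteq> \<zero>}"
      then have "{x. f x \<noteq> \<zero> \<and> \<phi> x = v} = {}" by auto
      with that show False by (simp add: linear_ext_def)
    qed
    have "finite (\<phi> ` {x. f x \<noteq> \<zero>})"
      using f by (simp add: free_module_sel)
    then have "finite {v. linear_ext R \<phi> f v \<noteq> \<zero>}"
      by (rule rev_finite_subset) (use supp in blast)
    moreover have "linear_ext R \<phi> f v = \<zero>" if "v \<notin> Y" for v
      using supp[of v] that fX \<phi> by auto
    moreover have "linear_ext R \<phi> f v \<in> carrier R" for v
      unfolding linear_ext_def by (rule finsum_closed) (use fc in auto)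
    ultimately show ?thesis
      by (simp add: free_module_sel)
  qed
  moreover have "linear_ext R \<phi> (\<lambda>x. f x \<oplus> g x) = (\<lambda>v. linear_ext R \<phi> f v \<oplus> linear_ext R \<phi> g v)"
    if f: "f \<in> carrier (free_module R X)" and g: "g \<in> carrier (free_module R X)" for f g
  proof
    fix v
    let ?S = "{x. f x \<noteq> \<zero>} \<union> {x. g x \<noteq> \<zero>}"
    have fc: "f x \<in> carrier R" "g x \<in> carrier R" for x
      using f g by (simp_all add: free_module_sel)
    have S: "finite ?S"
      using f g by (simp add: free_module_sel)
    have "linear_ext R \<phi> (\<lambda>x. f x \<oplus> g x) v = (\<Oplus>x\<in>?S. if \<phi> x = v then f x \<oplus> g x else \<zero>)"
      by (rule linear_ext_superset) (use fc S in auto)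
    also have "\<dots> = (\<Oplus>x\<in>?S. (if \<phi> x = v then f x else \<zero>) \<oplus> (if \<phi> x = v then g x else \<zero>))"
      by (rule finsum_cong') (use fc in auto)
    also have "\<dots> = (\<Oplus>x\<in>?S. if \<phi> x = v then f x else \<zero>) \<oplus> (\<Oplus>x\<in>?S. if \<phi> x = v then g x else \<zero>)"
      by (rule finsum_addf) (use fc in auto)
    also have "\<dots> = linear_ext R \<phi> f v \<oplus> linear_ext R \<phi> g v"
      using fc S by (subst (1 2) linear_ext_superset[of _ ?S]) auto
    finally show "linear_ext R \<phi> (\<lambda>x. f x \<oplus> g x) v = linear_ext R \<phi> f v \<oplus> linear_ext R \<phi> g v" .
  qed
  moreover have "linear_ext R \<phi> (\<lambda>x. a \<otimes> f x) = (\<lambda>v. a \<otimes> linear_ext R \<phi> f v)"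
    if a: "a \<in> carrier R" and f: "f \<in> carrier (free_module R X)" for a f
  proof
    fix v
    let ?S = "{x. f x \<noteq> \<zero>}"
    have fc: "f x \<in> carrier R" for x
      using f by (simp add: free_module_sel)
    have S: "finite ?S"
      using f by (simp add: free_module_sel)
    have "linear_ext R \<phi> (\<lambda>x. a \<otimes> f x) v = (\<Oplus>x\<in>?S. if \<phi> x = v then a \<otimes> f x else \<zero>)"
      by (rule linear_ext_superset) (use a fc S in auto)
    also have "\<dots> = (\<Oplus>x\<in>?S. a \<otimes> (if \<phi> x = v then f x else \<zero>))"
      by (rule finsum_cong') (use a fc in auto)
    also have "\<dots> = a \<otimes> (\<Oplus>x\<in>?S. if \<phi> x = v then f x else \<zero>)"
      by (rule finsum_rdistr[symmetric]) (use a fc S in auto)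
    also have "\<dots> = a \<otimes> linear_ext R \<phi> f v"
      using fc S by (subst linear_ext_superset[of _ ?S]) auto
    finally show "linear_ext R \<phi> (\<lambda>x. a \<otimes> f x) v = a \<otimes> linear_ext R \<phi> f v" .
  qed
  ultimately show ?thesis
    by (simp add: linear_maps_def free_module_sel(2,4))
qed

lemma (in cring) linear_ext_basis_vec: "linear_ext R \<phi> (basis_vec R x) = basis_vec R (\<phi> x)"
proof
  fix v
  have "linear_ext R \<phi> (basis_vec R x) v = (\<Oplus>y\<in>{x}. if \<phi> y = v then basis_vec R x y else \<zero>)"
    by (rule linear_ext_superset) (auto simp: basis_vec_def)
  also have "\<dots> = basis_vec R (\<phi> x) v"
    by (auto simp: basis_vec_def finsum_insert)
  finally show "linear_ext R \<phi> (basis_vec R x) v = basis_vec R (\<phi> x) v" .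
qed

text \<open>
  The coordinates of \<open>f \<otimes> g\<close> when the tensor product of the free modules on \<open>X\<close> and \<open>Y\<close> is
  identified with the free module on \<open>X \<times> Y\<close>.
\<close>

definition pure_tensor :: "('r, 'm) ring_scheme \<Rightarrow> ('x \<Rightarrow> 'r) \<Rightarrow> ('y \<Rightarrow> 'r) \<Rightarrow> 'x \<times> 'y \<Rightarrow> 'r" where
  "pure_tensor R f g = (\<lambda>p. f (fst p) \<otimes>\<^bsub>R\<^esub> g (snd p))"

lemma (in cring) pure_tensor_supp:
  assumes "\<And>x. f x \<in> carrier R" "\<And>y. g y \<in> carrier R"
  shows "{p. pure_tensor R f g p \<noteq> \<zero>} \<subseteq> {x. f x \<noteq> \<zero>} \<times> {y. g y \<noteq> \<zero>}"
  using assms by (auto simp: pure_tensor_def)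

lemma (in cring) pure_tensor_bilinear:
  "pure_tensor R \<in> bilinear_maps R (free_module R X) (free_module R Y) (free_module R (X \<times> Y))"
proof -
  have "pure_tensor R f g \<in> carrier (free_module R (X \<times> Y))"
    if f: "f \<in> carrier (free_module R X)" and g: "g \<in> carrier (free_module R Y)" for f g
  proof -
    have "finite ({x. f x \<noteq> \<zero>} \<times> {y. g y \<noteq> \<zero>})"
      using f g by (simp add: free_module_sel)
    then have "finite {p. pure_tensor R f g p \<noteq> \<zero>}"
      by (rule finite_subset[OF pure_tensor_supp, rotated 2]) (use f g in \<open>auto simp: free_module_sel\<close>)
    then show ?thesis
      using f g by (auto simp: free_module_sel pure_tensor_def)
  qed
  then show ?thesis
    by (auto simp: bilinear_maps_def linear_maps_def free_module_sel(2,4) pure_tensor_def)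
       (auto simp: free_module_sel(1) l_distr r_distr m_assoc m_lcomm)
qed

text \<open>
  This reduces bilinearity to linearity.  The sum on the left runs over all pairs from the
  two supports, where the products \<open>f x \<otimes> g y\<close> may vanish because the ring may have zero divisors; such
  pairs contribute nothing.
\<close>

lemma (in cring) bilinear_ext_eq_linear_ext:
  assumes f: "f \<in> carrier (free_module R X)" and g: "g \<in> carrier (free_module R Y)"
  shows "bilinear_ext R \<beta> f g = linear_ext R (case_prod \<beta>) (pure_tensor R f g)"
proof
  fix w
  have fc: "\<And>x. f x \<in> carrier R" "\<And>y. g y \<in> carrier R"
    using f g by (simp_all add: free_module_sel)
  let ?S = "{x. f x \<noteq> \<zero>} \<times> {y. g y \<noteq> \<zero>}"
  have S: "finite ?S"
    using f g by (simp add: free_module_sel)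
  have "linear_ext R (case_prod \<beta>) (pure_tensor R f g) w =
      (\<Oplus>p\<in>?S. if case_prod \<beta> p = w then pure_tensor R f g p else \<zero>)"
    by (rule linear_ext_superset[OF _ S pure_tensor_supp]) (use fc in \<open>auto simp: pure_tensor_def\<close>)
  also have "\<dots> = bilinear_ext R \<beta> f g w"
    unfolding bilinear_ext_def
    by (rule add.finprod_mono_neutral_cong_right) (use fc S in \<open>auto simp: pure_tensor_def\<close>)
  finally show "bilinear_ext R \<beta> f g w = linear_ext R (case_prod \<beta>) (pure_tensor R f g) w" ..
qed

lemma (in cring) bilinear_ext_bilinear:
  assumes \<beta>: "\<And>x y. x \<in> X \<Longrightarrow> y \<in> Y \<Longrightarrow> \<beta> x y \<in> Z"
  shows "bilinear_ext R \<beta> \<in> bilinear_maps R (free_module R X) (free_module R Y) (free_module R Z)"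
proof -
  have L: "linear_ext R (case_prod \<beta>) \<in> linear_maps R (free_module R (X \<times> Y)) (free_module R Z)"
    by (rule linear_ext_linear) (use \<beta> in auto)
  have cong: "h \<in> linear_maps R M N"
    if "k \<in> linear_maps R M N" "\<And>x. x \<in> carrier M \<Longrightarrow> h x = k x" "Module.module R M"
    for h k and M :: "('a, 'u, 'v) module_scheme" and N :: "('a, 'w, 'z) module_scheme"
  proof -
    interpret M: Module.module R M by (rule that)
    show ?thesis
      using that(1,2) by (auto simp: linear_maps_def Pi_iff)
  qed
  show ?thesis
    unfolding bilinear_maps_def
  proof (intro CollectI conjI ballI)
    fix f assume f: "f \<in> carrier (free_module R X)"
    show "bilinear_ext R \<beta> f \<in> linear_maps R (free_module R Y) (free_module R Z)"
      by (rule cong[OF linear_maps_comp[OF bilinear_maps_right[OF pure_tensor_bilinear f] L]])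
         (use f in \<open>auto intro: bilinear_ext_eq_linear_ext free_module_module\<close>)
  next
    fix g assume g: "g \<in> carrier (free_module R Y)"
    show "(\<lambda>f. bilinear_ext R \<beta> f g) \<in> linear_maps R (free_module R X) (free_module R Z)"
      by (rule cong[OF linear_maps_comp[OF bilinear_maps_left[OF pure_tensor_bilinear g] L]])
         (use g in \<open>auto intro: bilinear_ext_eq_linear_ext free_module_module\<close>)
  qed
qed

lemma (in cring) bilinear_ext_basis_vec:
  "bilinear_ext R \<beta> (basis_vec R x) (basis_vec R y) = basis_vec R (\<beta> x y)"
proof -
  have "bilinear_ext R \<beta> (basis_vec R x) (basis_vec R y) =
      linear_ext R (case_prod \<beta>) (pure_tensor R (basis_vec R x) (basis_vec R y))"
    by (rule bilinear_ext_eq_linear_ext[of _ "{x}" _ "{y}"]) (simp_all add: basis_vec_closed)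
  also have "pure_tensor R (basis_vec R x) (basis_vec R y) = basis_vec R (x, y)"
    by (auto simp: pure_tensor_def basis_vec_def)
  finally show ?thesis
    by (simp add: linear_ext_basis_vec)
qed

section \<open>Operads of sets and their linearization\<close>

text \<open>
  The axioms of a non-symmetric operad for composition maps that send basis elements to basis
  elements, as is the case for permutations and for trees.
\<close>

locale ns_set_operad =
  fixes X :: "nat \<Rightarrow> 'x set" and ins :: "nat \<Rightarrow> 'x \<Rightarrow> 'x \<Rightarrow> 'x" and e :: 'x
  assumes ins_closed:
      "\<lbrakk>m \<ge> 1; 1 \<le> i; i \<le> n; x \<in> X n; y \<in> X m\<rbrakk> \<Longrightarrow> ins i x y \<in> X (n + m - 1)"
    and e_closed: "e \<in> X 1"
    and ins_parallel:
      "\<lbrakk>m \<ge> 1; l \<ge> 1; x \<in> X n; y \<in> X m; z \<in> X l; 1 \<le> i; i < j; j \<le> n\<rbrakk> \<Longrightarrow>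
       ins (j + m - 1) (ins i x y) z = ins i (ins j x z) y"
    and ins_sequential:
      "\<lbrakk>l \<ge> 1; x \<in> X n; y \<in> X m; z \<in> X l; 1 \<le> i; i \<le> n; 1 \<le> j; j \<le> m\<rbrakk> \<Longrightarrow>
       ins (i + j - 1) (ins i x y) z = ins i x (ins j y z)"
    and ins_unit_right: "\<lbrakk>x \<in> X n; 1 \<le> i; i \<le> n\<rbrakk> \<Longrightarrow> ins i x e = x"
    and ins_unit_left: "\<lbrakk>n \<ge> 1; x \<in> X n\<rbrakk> \<Longrightarrow> ins 1 e x = x"

text \<open>
  Both sides of each axiom are multilinear, so that it is enough to compare them on basis vectors,
  where they are the corresponding axiom for the underlying sets.
\<close>

lemma (in ns_set_operad) linearization:
  assumes "cring R"
  shows "ns_operad R (\<lambda>n. free_module R (X n)) (\<lambda>n m i. bilinear_ext R (ins i)) (basis_vec R e)"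
proof -
  interpret R: cring R by (rule assms)
  have bil: "bilinear_ext R (ins i) \<in>
      bilinear_maps R (free_module R (X n)) (free_module R (X m)) (free_module R (X k))"
    if "m \<ge> 1" "1 \<le> i" "i \<le> n" "k = n + m - 1" for i n m k
    unfolding that(4) by (rule R.bilinear_ext_bilinear) (rule ins_closed[OF that(1-3)])
  show ?thesis
  proof (intro ns_operad.intro[OF assms] ns_operad_axioms.intro, goal_cases)
    case (1 n)
    show ?case by (rule R.free_module_module)
  next
    case (2 n m i)
    then show ?case by (intro bil) simp_all
  next
    case 3
    show ?case by (rule R.basis_vec_closed[OF e_closed])
  next
    case (4 n m l x y z i j)
    show ?case
    proof (rule R.trilinear_maps_basis_eqI[OF _ _ R.free_module_module[of "X (n + m + l - 2)"] _ 4(4-6)])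
      show "(\<lambda>x y z. bilinear_ext R (ins (j + m - 1)) (bilinear_ext R (ins i) x y) z) \<in>
        trilinear_maps R (free_module R (X n)) (free_module R (X m)) (free_module R (X l))
          (free_module R (X (n + m + l - 2)))"
        by (rule trilinear_maps_comp_left[OF bil[of m i n "n + m - 1"] bil]) (use 4 in auto)
      show "(\<lambda>x y z. bilinear_ext R (ins i) (bilinear_ext R (ins j) x z) y) \<in>
        trilinear_maps R (free_module R (X n)) (free_module R (X m)) (free_module R (X l))
          (free_module R (X (n + m + l - 2)))"
        by (rule trilinear_maps_swap[OF trilinear_maps_comp_left[OF bil[of l j n "n + l - 1"] bil]]) (use 4 in auto)
    qed (use 4 in \<open>simp add: R.bilinear_ext_basis_vec ins_parallel[of m l _ n] del: One_nat_def\<close>)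
  next
    case (5 n m l x y z i j)
    show ?case
    proof (rule R.trilinear_maps_basis_eqI[OF _ _ R.free_module_module[of "X (n + m + l - 2)"] _ 5(4-6)])
      show "(\<lambda>x y z. bilinear_ext R (ins (i + j - 1)) (bilinear_ext R (ins i) x y) z) \<in>
        trilinear_maps R (free_module R (X n)) (free_module R (X m)) (free_module R (X l))
          (free_module R (X (n + m + l - 2)))"
        by (rule trilinear_maps_comp_left[OF bil[of m i n "n + m - 1"] bil]) (use 5 in auto)
      show "(\<lambda>x y z. bilinear_ext R (ins i) x (bilinear_ext R (ins j) y z)) \<in>
        trilinear_maps R (free_module R (X n)) (free_module R (X m)) (free_module R (X l))
          (free_module R (X (n + m + l - 2)))"
        by (rule trilinear_maps_comp_right[OF bil[of l j m "m + l - 1"] bil]) (use 5 in auto)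
    qed (use 5 in \<open>simp add: R.bilinear_ext_basis_vec ins_sequential[of l _ n _ m] del: One_nat_def\<close>)
  next
    case (6 n x i)
    show ?case
      by (rule R.linear_maps_basis_eqI[where h = "\<lambda>x. bilinear_ext R (ins i) x (basis_vec R e)"
            and k = "\<lambda>x. x", OF bilinear_maps_left[OF bil R.basis_vec_closed[OF e_closed]]
            id_linear R.free_module_module _ 6(2)])
         (use 6 in \<open>auto simp: R.bilinear_ext_basis_vec ins_unit_right[of _ n]\<close>)
  next
    case (7 n x)
    show ?case
      by (rule R.linear_maps_basis_eqI[where h = "bilinear_ext R (ins 1) (basis_vec R e)"
            and k = "\<lambda>x. x", OF bilinear_maps_right[OF bil R.basis_vec_closed[OF e_closed]]
            id_linear R.free_module_module _ 7(2)])
         (use 7 in \<open>auto simp: R.bilinear_ext_basis_vec ins_unit_left[of n] simp del: One_nat_def\<close>)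
  qed
qed

locale ns_set_operad_morphism =
  A: ns_set_operad X insX eX + B: ns_set_operad Y insY eY
  for X :: "nat \<Rightarrow> 'x set" and insX eX and Y :: "nat \<Rightarrow> 'y set" and insY eY +
  fixes \<pi> :: "'x \<Rightarrow> 'y"
  assumes map_closed: "\<lbrakk>n \<ge> 1; x \<in> X n\<rbrakk> \<Longrightarrow> \<pi> x \<in> Y n"
    and map_ins: "\<lbrakk>m \<ge> 1; 1 \<le> i; i \<le> n; x \<in> X n; y \<in> X m\<rbrakk> \<Longrightarrow>
      \<pi> (insX i x y) = insY i (\<pi> x) (\<pi> y)"
    and map_unit: "\<pi> eX = eY"

lemma (in ns_set_operad_morphism) linearization:
  assumes "cring R"
  shows "ns_operad_morphism R
    (\<lambda>n. free_module R (X n)) (\<lambda>n m i. bilinear_ext R (insX i)) (basis_vec R eX)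
    (\<lambda>n. free_module R (Y n)) (\<lambda>n m i. bilinear_ext R (insY i)) (basis_vec R eY)
    (\<lambda>n. linear_ext R \<pi>)"
proof -
  interpret R: cring R by (rule assms)
  interpret LA: ns_operad R "\<lambda>n. free_module R (X n)" "\<lambda>n m i. bilinear_ext R (insX i)" "basis_vec R eX"
    by (rule A.linearization[OF assms])
  interpret LB: ns_operad R "\<lambda>n. free_module R (Y n)" "\<lambda>n m i. bilinear_ext R (insY i)" "basis_vec R eY"
    by (rule B.linearization[OF assms])
  have lin: "linear_ext R \<pi> \<in> linear_maps R (free_module R (X n)) (free_module R (Y n))"
    if "n \<ge> 1" for n
    by (rule R.linear_ext_linear) (rule map_closed[OF that])
  show ?thesis
  proof (intro ns_operad_morphism.intro ns_operad_morphism_axioms.intro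
      LA.ns_operad_axioms LB.ns_operad_axioms, goal_cases)
    case (1 n)
    then show ?case by (rule lin)
  next
    case (2 n m i x y)
    show ?case
    proof (rule R.bilinear_maps_basis_eqI[OF _ _ R.free_module_module[of "Y (n + m - 1)"] _ 2(5,6)])
      have "n + m - 1 \<ge> 1"
        using 2 by simp
      then show "(\<lambda>x y. linear_ext R \<pi> (bilinear_ext R (insX i) x y)) \<in>
          bilinear_maps R (free_module R (X n)) (free_module R (X m)) (free_module R (Y (n + m - 1)))"
        by (intro bilinear_maps_comp_outer[OF LA.comp_bilinear[OF 2(1-4)] lin])
      show "(\<lambda>x y. bilinear_ext R (insY i) (linear_ext R \<pi> x) (linear_ext R \<pi> y)) \<in>
          bilinear_maps R (free_module R (X n)) (free_module R (X m)) (free_module R (Y (n + m - 1)))"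
        by (rule bilinear_maps_comp_inner[OF lin[OF 2(1)] lin[OF 2(2)] LB.comp_bilinear[OF 2(1-4)]])
    qed (use 2 in \<open>simp add: R.bilinear_ext_basis_vec R.linear_ext_basis_vec map_ins[of m i n]\<close>)
  next
    case 3
    show ?case by (simp add: R.linear_ext_basis_vec map_unit)
  qed
qed

text \<open>
  The linear extension of a section of \<open>\<phi>\<close> is a section of the linear extension of \<open>\<phi>\<close>.
\<close>

lemma (in cring) linear_ext_surj:
  assumes sub: "\<And>x. x \<in> X \<Longrightarrow> \<phi> x \<in> Y" and surj: "Y \<subseteq> \<phi> ` X"
  shows "linear_ext R \<phi> ` carrier (free_module R X) = carrier (free_module R Y)"
proof
  show "linear_ext R \<phi> ` carrier (free_module R X) \<subseteq> carrier (free_module R Y)"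
    using linear_maps_closed[OF linear_ext_linear[where \<phi> = \<phi>, OF sub]] by blast
  let ?s = "inv_into X \<phi>"
  have s: "linear_ext R ?s \<in> linear_maps R (free_module R Y) (free_module R X)"
    by (rule linear_ext_linear) (use surj in \<open>auto intro: inv_into_into\<close>)
  show "carrier (free_module R Y) \<subseteq> linear_ext R \<phi> ` carrier (free_module R X)"
  proof
    fix g assume g: "g \<in> carrier (free_module R Y)"
    have "linear_ext R \<phi> (linear_ext R ?s g) = g"
      by (rule linear_maps_basis_eqI[where k = "\<lambda>x. x",
            OF linear_maps_comp[OF s linear_ext_linear] id_linear free_module_module _ g])
         (use sub surj in \<open>auto simp: linear_ext_basis_vec f_inv_into_f\<close>)
    then show "g \<in> linear_ext R \<phi> ` carrier (free_module R X)"
      using linear_maps_closed[OF s g] by (metis image_eqI)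
  qed
qed

text \<open>
  An identity between compositions passes to the image of a surjection that commutes with them:
  choose preimages of the arguments and apply the map to the identity upstairs.
\<close>

lemma (in ns_set_operad) surjective_image:
  assumes sub: "\<And>n x. x \<in> X n \<Longrightarrow> \<pi> x \<in> Y n" and surj: "\<And>n. Y n \<subseteq> \<pi> ` X n"
    and hom: "\<And>m i n x y. \<lbrakk>m \<ge> 1; 1 \<le> i; i \<le> n; x \<in> X n; y \<in> X m\<rbrakk> \<Longrightarrow>
      \<pi> (ins i x y) = insY i (\<pi> x) (\<pi> y)"
  shows "ns_set_operad Y insY (\<pi> e)"
proof -
  note [simp del] = One_nat_def
  have pre: "\<exists>x\<in>X n. y = \<pi> x" if "y \<in> Y n" for n y
    using surj[of n] that by blast
  show ?thesis
  proof (unfold_locales, goal_cases)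
    case (1 m i n x y)
    then show ?case
      using sub[OF ins_closed[of m i n]] hom[of m i n] by (metis pre)
  next
    case 2
    show ?case by (rule sub[OF e_closed])
  next
    case (3 m l x n y z i j)
    obtain x' y' z' where x': "x' \<in> X n" "x = \<pi> x'" and y': "y' \<in> X m" "y = \<pi> y'"
      and z': "z' \<in> X l" "z = \<pi> z'"
      using 3 pre by meson
    have "insY (j + m - 1) (insY i x y) z = \<pi> (ins (j + m - 1) (ins i x' y') z')"
      using 3 x' y' z' ins_closed[of m i n x' y']
        hom[of m i n x' y'] hom[of l "j + m - 1" "n + m - 1" "ins i x' y'" z'] by simp
    also have "\<dots> = \<pi> (ins i (ins j x' z') y')"
      using 3 x' y' z' by (subst ins_parallel[of m l x' n]) auto
    also have "\<dots> = insY i (insY j x z) y"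
      using 3 x' y' z' ins_closed[of l j n x' z']
        hom[of l j n x' z'] hom[of m i "n + l - 1" "ins j x' z'" y'] by simp
    finally show ?case .
  next
    case (4 l x n y m z i j)
    obtain x' y' z' where x': "x' \<in> X n" "x = \<pi> x'" and y': "y' \<in> X m" "y = \<pi> y'"
      and z': "z' \<in> X l" "z = \<pi> z'"
      using 4 pre by meson
    have "insY (i + j - 1) (insY i x y) z = \<pi> (ins (i + j - 1) (ins i x' y') z')"
      using 4 x' y' z' ins_closed[of m i n x' y']
        hom[of m i n x' y'] hom[of l "i + j - 1" "n + m - 1" "ins i x' y'" z'] by simp
    also have "\<dots> = \<pi> (ins i x' (ins j y' z'))"
      using 4 x' y' z' by (subst ins_sequential[of l x' n y' m]) auto
    also have "\<dots> = insY i x (insY j y z)"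
      using 4 x' y' z' ins_closed[of l j m y' z']
        hom[of l j m y' z'] hom[of "m + l - 1" i n x' "ins j y' z'"] by simp
    finally show ?case .
  next
    case (5 x n i)
    then show ?case
      using hom[of 1 i n _ e] e_closed ins_unit_right[of _ n i] pre[of x n] by auto
  next
    case (6 n x)
    then show ?case
      using hom[of n 1 1 e] e_closed ins_unit_left[of n] pre[of x n] by auto
  qed
qed

section \<open>Insertion of permutations\<close>

lemma perms_iff: "\<sigma> \<in> perms n \<longleftrightarrow> distinct \<sigma> \<and> set \<sigma> = {1..n}"
  by (auto simp: perms_def permutations_of_set_def)

lemma perms_length: "\<sigma> \<in> perms n \<Longrightarrow> length \<sigma> = n"
  by (metis perms_iff distinct_card card_atLeastAtMost diff_Suc_1)

lemma permsI: "set xs = {1..n} \<Longrightarrow> length xs = n \<Longrightarrow> xs \<in> perms n"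
  by (simp add: perms_iff card_distinct)

text \<open>
  The relabelling of the letters of \<open>\<sigma>\<close> other than \<open>p\<close> that makes room for \<open>m\<close> consecutive values
  in place of \<open>p\<close>.
\<close>

definition stretch :: "nat \<Rightarrow> nat \<Rightarrow> nat \<Rightarrow> nat" where
  "stretch p m q = (if q < p then q else q + m - 1)"

text \<open>
  Splitting \<open>\<sigma>\<close> at the insertion point turns the operad axioms for permutations into identities
  between relabellings of single letters.
\<close>

lemma perm_insert_append:
  "i = Suc (length u) \<Longrightarrow> perm_insert i (u @ p # v) \<tau> =
    map (stretch p (length \<tau>)) u @ map (\<lambda>q. q + p - 1) \<tau> @ map (stretch p (length \<tau>)) v"
  by (simp add: perm_insert_def Let_def stretch_def[abs_def])

lemma perms_split:
  assumes "\<sigma> \<in> perms n" "1 \<le> i" "i \<le> n"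
  obtains u p v where "\<sigma> = u @ p # v" "i = Suc (length u)" "p \<ge> 1" "p \<le> n"
    "set u \<union> set v = {1..n} - {p}"
proof
  let ?u = "take (i - 1) \<sigma>" and ?p = "\<sigma> ! (i - 1)" and ?v = "drop i \<sigma>"
  show *: "\<sigma> = ?u @ ?p # ?v"
    using assms perms_length[OF assms(1)] id_take_nth_drop[of "i - 1" \<sigma>] by simp
  show "i = Suc (length ?u)"
    using assms perms_length[OF assms(1)] by simp
  have "?p \<in> set \<sigma>"
    using assms perms_length[OF assms(1)] by simp
  then show "?p \<ge> 1" "?p \<le> n"
    using assms(1) by (simp_all add: perms_iff)
  have "distinct (?u @ ?p # ?v)" "set (?u @ ?p # ?v) = {1..n}"
    using * assms(1) by (simp_all add: perms_iff)
  then have "?p \<notin> set ?u \<union> set ?v" "insert ?p (set ?u \<union> set ?v) = {1..n}"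
    by simp_all
  then show "set ?u \<union> set ?v = {1..n} - {?p}"
    by blast
qed

lemma perm_insert_closed:
  assumes m: "m \<ge> 1" and i: "1 \<le> i" "i \<le> n" and \<sigma>: "\<sigma> \<in> perms n" and \<tau>: "\<tau> \<in> perms m"
  shows "perm_insert i \<sigma> \<tau> \<in> perms (n + m - 1)"
proof -
  obtain u p v where upv: "\<sigma> = u @ p # v" "i = Suc (length u)" "p \<ge> 1" "p \<le> n"
    and uv: "set u \<union> set v = {1..n} - {p}"
    by (rule perms_split[OF \<sigma> i])
  have lens: "length \<tau> = m" "length u + length v + 1 = n"
    using perms_length[OF \<tau>] perms_length[OF \<sigma>] upv by simp_all
  have eq: "perm_insert i \<sigma> \<tau> = map (stretch p m) u @ map (\<lambda>q. q + p - 1) \<tau> @ map (stretch p m) v"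
    using perm_insert_append[OF upv(2)] upv(1) lens by simp
  show ?thesis
  proof (rule permsI)
    have "set (perm_insert i \<sigma> \<tau>) = stretch p m ` (set u \<union> set v) \<union> (\<lambda>q. q + p - 1) ` set \<tau>"
      by (auto simp: eq)
    also have "\<dots> = stretch p m ` ({1..n} - {p}) \<union> (\<lambda>q. q + p - 1) ` {1..m}"
      using \<tau> by (simp add: uv perms_iff)
    also have "\<dots> = {1..n + m - 1}"
    proof (intro equalityI subsetI)
      fix x assume "x \<in> stretch p m ` ({1..n} - {p}) \<union> (\<lambda>q. q + p - 1) ` {1..m}"
      then show "x \<in> {1..n + m - 1}"
        using upv m by (auto simp: stretch_def)
    next
      fix x assume x: "x \<in> {1..n + m - 1}"
      \<comment> \<open>The values below \<open>p\<close> are unchanged, the next \<open>m\<close> values are those of \<open>\<tau>\<close>, and the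
          remaining ones were shifted up by \<open>m - 1\<close>.\<close>
      consider "x < p" | "p \<le> x" "x < p + m" | "x \<ge> p + m"
        by linarith
      then show "x \<in> stretch p m ` ({1..n} - {p}) \<union> (\<lambda>q. q + p - 1) ` {1..m}"
      proof cases
        case 1
        then show ?thesis
          using x upv by (intro UnI1 image_eqI[of _ _ x]) (auto simp: stretch_def)
      next
        case 2
        then show ?thesis
          using x upv by (intro UnI2 image_eqI[of _ _ "x + 1 - p"]) auto
      next
        case 3
        then show ?thesis
          using x upv m by (intro UnI1 image_eqI[of _ _ "x + 1 - m"]) (auto simp: stretch_def)
      qed
    qed
    finally show "set (perm_insert i \<sigma> \<tau>) = {1..n + m - 1}" .
    show "length (perm_insert i \<sigma> \<tau>) = n + m - 1"
      using lens by (simp add: eq)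
  qed
qed

text \<open>
  After splitting \<open>x\<close> at its letters \<open>p\<close> and \<open>q\<close> in positions \<open>i\<close> and \<open>j\<close>, both sides consist of the
  same five blocks.  Every letter is moved up by \<open>m - 1\<close> if it lies above \<open>p\<close> and by \<open>l - 1\<close> if it
  lies above \<open>q\<close>, in either order; the letters of \<open>y\<close> and \<open>z\<close> compare with the others as \<open>p\<close> and
  \<open>q\<close> do.
\<close>

lemma perm_insert_parallel:
  assumes "m \<ge> 1" "l \<ge> 1" and x: "x \<in> perms n" and y: "y \<in> perms m" and z: "z \<in> perms l"
    and ij: "1 \<le> i" "i < j" "j \<le> n"
  shows "perm_insert (j + m - 1) (perm_insert i x y) z = perm_insert i (perm_insert j x z) y"
proof -
  have "i \<le> n"
    using ij by simp
  obtain u p w where x1: "x = u @ p # w" "i = Suc (length u)"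
    by (rule perms_split[OF x ij(1) \<open>i \<le> n\<close>])
  obtain v q v' where w: "w = v @ q # v'" and j: "j = Suc (length (u @ p # v))"
  proof
    let ?k = "j - i - 1"
    have k: "?k < length w"
      using perms_length[OF x] x1 ij by simp
    show "w = take ?k w @ w ! ?k # drop (Suc ?k) w"
      using k by (rule id_take_nth_drop)
    show "j = Suc (length (u @ p # take ?k w))"
      using k x1(2) ij by simp
  qed
  have lens: "length y = m" "length z = l"
    using perms_length y z by auto
  have d: "distinct (u @ p # v @ q # v')"
    using x x1 w by (simp add: perms_iff)
  have pos: "r \<ge> 1" if "r \<in> set y \<union> set z" for r
    using that y z by (auto simp: perms_iff)
  have upper: "r \<in> set y \<Longrightarrow> r \<le> m" "r \<in> set z \<Longrightarrow> r \<le> l" for r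
    using y z by (auto simp: perms_iff)
  have pq: "p \<ge> 1" "q \<ge> 1"
    using x x1 w by (auto simp: perms_iff)
  have xy: "perm_insert i x y = (map (stretch p m) u @ map (\<lambda>q. q + p - 1) y @ map (stretch p m) v)
      @ stretch p m q # map (stretch p m) v'"
    using perm_insert_append[OF x1(2)] lens by (simp add: x1(1) w)
  have xz: "perm_insert j x z = map (stretch q l) u @ stretch q l p
      # (map (stretch q l) v @ map (\<lambda>r. r + q - 1) z @ map (stretch q l) v')"
    using perm_insert_append[OF j] lens by (simp add: x1(1) w)
  show ?thesis
    unfolding xy xz
    using lens d pos pq assms(1,2)
    by (subst (1 2) perm_insert_append)
      (auto simp: x1(2) j stretch_def dest!: upper)
qed

lemma perm_insert_sequential:
  assumes "l \<ge> 1" and x: "x \<in> perms n" and y: "y \<in> perms m" and z: "z \<in> perms l"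
    and ij: "1 \<le> i" "i \<le> n" "1 \<le> j" "j \<le> m"
  shows "perm_insert (i + j - 1) (perm_insert i x y) z = perm_insert i x (perm_insert j y z)"
proof -
  obtain u p v where x1: "x = u @ p # v" "i = Suc (length u)"
    and p: "p \<ge> 1" "p \<le> n" and uv: "set u \<union> set v = {1..n} - {p}"
    by (rule perms_split[OF x ij(1,2)])
  obtain u' q v' where y1: "y = u' @ q # v'" "j = Suc (length u')"
    and q: "q \<ge> 1" "q \<le> m" and uv': "set u' \<union> set v' = {1..m} - {q}"
    by (rule perms_split[OF y ij(3,4)])
  have lens: "length y = m" "length z = l"
    using perms_length y z by auto
  have len: "length (perm_insert j y z) = m + l - 1"
    by (rule perms_length[OF perm_insert_closed]) (use assms in auto)
  have zpos: "r \<ge> 1" if "r \<in> set z" for r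
    using that z by (auto simp: perms_iff)
  have pos: "r \<ge> 1" "r \<noteq> q" if "r \<in> set u' \<union> set v'" for r
    using that uv' by auto
  have ne: "r \<noteq> p" if "r \<in> set u \<union> set v" for r
    using that uv by auto
  have xy: "perm_insert i x y = (map (stretch p m) u @ map (\<lambda>q. q + p - 1) u')
      @ (q + p - 1) # (map (\<lambda>q. q + p - 1) v' @ map (stretch p m) v)"
    using perm_insert_append[OF x1(2)] lens by (simp add: x1(1) y1(1))
  have yz: "perm_insert j y z = map (stretch q l) u' @ map (\<lambda>r. r + q - 1) z @ map (stretch q l) v'"
    using perm_insert_append[OF y1(2)] lens by (simp add: y1(1))
  have xyz: "perm_insert i x (perm_insert j y z) =
    map (stretch p (m + l - 1)) u @ map (\<lambda>q. q + p - 1) (perm_insert j y z)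
      @ map (stretch p (m + l - 1)) v"
    using perm_insert_append[OF x1(2)] by (simp add: x1(1) len)
  show ?thesis
    unfolding xyz unfolding xy yz
    using lens zpos pos ne p q assms(1)
    by (subst perm_insert_append)
      (auto simp: x1(2) y1(2) stretch_def)
qed

lemma perm_insert_unit_right:
  assumes "x \<in> perms n" "1 \<le> i" "i \<le> n"
  shows "perm_insert i x [1] = x"
proof -
  obtain u p v where x: "x = u @ p # v" "i = Suc (length u)"
    by (rule perms_split[OF assms])
  show ?thesis
    unfolding x(1) by (subst perm_insert_append[OF x(2)]) (simp add: stretch_def map_idI)
qed

lemma perm_insert_unit_left: "perm_insert 1 [1] x = x"
  by (simp add: perm_insert_def Let_def)

section \<open>Decreasing trees of words\<close>

text \<open>
  An increasing relabelling \<open>f\<close> maps the letters up to \<open>x\<close> bijectively to those up to \<open>f x\<close>, so all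
  ranks stay the same.
\<close>

lemma std_map:
  assumes "strict_mono_on (set xs) f"
  shows "std (map f xs) = std xs"
proof -
  have "card {y \<in> f ` set xs. y \<le> f x} = card {y \<in> set xs. y \<le> x}" if x: "x \<in> set xs" for x
  proof -
    have "{y \<in> f ` set xs. y \<le> f x} = f ` {y \<in> set xs. y \<le> x}"
      using assms x by (auto simp: strict_mono_on_leD strict_mono_on_less_eq)
    moreover have "inj_on f {y \<in> set xs. y \<le> x}"
      using strict_mono_on_imp_inj_on[OF assms] by (rule inj_on_subset) auto
    ultimately show ?thesis
      by (simp add: card_image)
  qed
  then show ?thesis
    by (simp add: std_def)
qed

lemma std_perm:
  assumes "\<sigma> \<in> perms n"
  shows "std \<sigma> = \<sigma>"
proof -
  have "card {y \<in> set \<sigma>. y \<le> x} = x" if "x \<in> set \<sigma>" for x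
  proof -
    have "{y \<in> set \<sigma>. y \<le> x} = {1..x}"
      using assms that by (auto simp: perms_iff)
    then show ?thesis by simp
  qed
  then show ?thesis
    by (simp add: std_def map_idI)
qed

text \<open>
  Standardizing first extends \<open>perm_tree\<close> to all words without repetitions.  Subwords of
  permutations are then covered without renumbering them, which inductions on the position of
  the largest letter need.
\<close>

definition decreasing_tree :: "nat list \<Rightarrow> pbtree" where
  "decreasing_tree xs = perm_tree (std xs)"

lemma decreasing_tree_perm: "\<sigma> \<in> perms n \<Longrightarrow> decreasing_tree \<sigma> = perm_tree \<sigma>"
  by (simp add: decreasing_tree_def std_perm)

lemma decreasing_tree_map:
  "strict_mono_on (set xs) f \<Longrightarrow> decreasing_tree (map f xs) = decreasing_tree xs"
  by (simp add: decreasing_tree_def std_map)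

lemma decreasing_tree_Nil [simp]: "decreasing_tree [] = Leaf"
  by (simp add: decreasing_tree_def std_def perm_tree.simps)

text \<open>
  Standardization replaces letters by their ranks.  The rank of the largest letter is the length of
  the word, and on either side of it the ranks have the relative order of the original letters.
\<close>

lemma decreasing_tree_append:
  assumes d: "distinct (u @ p # v)" and max: "\<And>x. x \<in> set u \<union> set v \<Longrightarrow> x < p"
  shows "decreasing_tree (u @ p # v) = Graft (decreasing_tree u) (decreasing_tree v)"
proof -
  let ?xs = "u @ p # v"
  define rank where "rank x = card {y \<in> set ?xs. y \<le> x}" for x
  have mono: "strict_mono_on (set ?xs) rank"
  proof (rule strict_mono_onI)
    fix r s assume rs: "r \<in> set ?xs" "s \<in> set ?xs" "r < s"
    have "{y \<in> set ?xs. y \<le> r} \<subset> {y \<in> set ?xs. y \<le> s}"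
    proof
      show "{y \<in> set ?xs. y \<le> r} \<subseteq> {y \<in> set ?xs. y \<le> s}"
        using rs by auto
      have "s \<in> {y \<in> set ?xs. y \<le> s}" "s \<notin> {y \<in> set ?xs. y \<le> r}"
        using rs by auto
      then show "{y \<in> set ?xs. y \<le> r} \<noteq> {y \<in> set ?xs. y \<le> s}"
        by blast
    qed
    then show "rank r < rank s"
      unfolding rank_def by (rule psubset_card_mono[rotated]) simp
  qed
  have std: "std ?xs = map rank u @ rank p # map rank v"
    by (simp add: std_def rank_def)
  have "{y \<in> set ?xs. y \<le> p} = set ?xs"
    using max by (auto simp: less_imp_le)
  then have rank_p: "rank p = length ?xs"
    using d unfolding rank_def by (metis distinct_card)
  have lt: "rank x \<noteq> rank p" if "x \<in> set u" for x
    using strict_mono_onD[OF mono, of x p] max[of x] that by auto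
  have tw: "takeWhile (\<lambda>x. x \<noteq> length ?xs) (map rank u @ rank p # map rank v) = map rank u"
    using lt rank_p by (subst takeWhile_append2) auto
  have "perm_tree (std ?xs) = Graft (perm_tree (std (map rank u))) (perm_tree (std (map rank v)))"
    using tw rank_p by (subst perm_tree.simps) (simp add: std Let_def)
  moreover have "strict_mono_on (set u) rank" "strict_mono_on (set v) rank"
    using mono by (auto simp: strict_mono_on_def)
  ultimately show ?thesis
    by (simp add: decreasing_tree_def std_map)
qed

lemma split_at_max:
  fixes xs :: "nat list"
  assumes "distinct xs" "xs \<noteq> []"
  obtains u p v where "xs = u @ p # v" "\<And>x. x \<in> set u \<union> set v \<Longrightarrow> x < p"
proof -
  have "Max (set xs) \<in> set xs"
    using assms by (intro Max_in) auto
  then obtain u v where xs: "xs = u @ Max (set xs) # v"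
    by (meson split_list)
  have "x < Max (set xs)" if x: "x \<in> set u \<union> set v" for x
  proof -
    have "x \<in> set xs"
      using x by (subst xs) auto
    then have "x \<le> Max (set xs)"
      by simp
    moreover have "distinct (u @ Max (set xs) # v)"
      using assms(1) xs by simp
    then have "x \<noteq> Max (set xs)"
      using x by auto
    ultimately show ?thesis by simp
  qed
  with xs show ?thesis
    by (rule that)
qed

lemma distinct_max_induct [consumes 1, case_names Nil split]:
  fixes xs :: "nat list"
  assumes "distinct xs" "P []"
    and "\<And>u p v. \<lbrakk>distinct (u @ p # v); \<And>x. x \<in> set u \<union> set v \<Longrightarrow> x < p; P u; P v\<rbrakk> \<Longrightarrow> P (u @ p # v)"
  shows "P xs"
  using assms(1)
proof (induction xs rule: length_induct)
  case (1 xs)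
  show ?case
  proof (cases "xs = []")
    case False
    obtain u p v where xs: "xs = u @ p # v" and max: "\<And>x. x \<in> set u \<union> set v \<Longrightarrow> x < p"
      using split_at_max[OF 1(2) False] by metis
    show ?thesis
      unfolding xs using 1 by (intro assms(3) max) (auto simp: xs)
  qed (use assms(2) in simp)
qed

lemma size_decreasing_tree: "distinct xs \<Longrightarrow> size (decreasing_tree xs) = length xs"
proof (induction xs rule: distinct_max_induct)
  case (split u p v)
  then show ?case
    using decreasing_tree_append[OF split(1,2)] by simp
qed simp

text \<open>
  The largest letter of \<open>xs @ ys\<close> lies in \<open>ys\<close>, so that the letters of \<open>ys\<close> are split off before any
  letter of \<open>xs\<close>, and \<open>xs\<close> always stays in the left part: it ends up at the leftmost leaf.
\<close>

lemma decreasing_tree_over: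
  assumes "distinct ys" "distinct xs" "\<And>x y. x \<in> set xs \<Longrightarrow> y \<in> set ys \<Longrightarrow> x < y"
  shows "decreasing_tree (xs @ ys) = over (decreasing_tree xs) (decreasing_tree ys)"
  using assms
proof (induction ys rule: distinct_max_induct)
  case (split u p v)
  have "decreasing_tree ((xs @ u) @ p # v) = Graft (decreasing_tree (xs @ u)) (decreasing_tree v)"
    by (rule decreasing_tree_append) (use split in force)+
  then show ?case
    using split decreasing_tree_append[OF split(1,2)] by simp
qed simp

text \<open>
  Mirror image of the previous lemma: \<open>ys\<close> ends up at the rightmost leaf of the tree of \<open>xs\<close>.
\<close>

lemma decreasing_tree_under:
  assumes "distinct xs" "distinct ys" "\<And>x y. x \<in> set xs \<Longrightarrow> y \<in> set ys \<Longrightarrow> y < x"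
  shows "decreasing_tree (xs @ ys) = under (decreasing_tree xs) (decreasing_tree ys)"
  using assms
proof (induction xs rule: distinct_max_induct)
  case (split u p v)
  have "decreasing_tree (u @ p # (v @ ys)) = Graft (decreasing_tree u) (decreasing_tree (v @ ys))"
    by (rule decreasing_tree_append) (use split in force)+
  then show ?case
    using split decreasing_tree_append[OF split(1,2)] by simp
qed simp

text \<open>
  Replacing the letter \<open>p\<close> of a word by a block of letters that compare with the others as \<open>p\<close> did
  is insertion of trees.  Only the relative order is prescribed, by \<open>f\<close> for the old letters and by
  \<open>g\<close> for the block, so that the statement can be applied again to the part of the word to the left
  or to the right of its largest letter \<open>M\<close>.
  
  If \<open>M\<close> is not \<open>p\<close>, it remains the largest letter and hence the root, and the insertion takes place
  in one of the two subtrees.  If \<open>M = p\<close>, all other old letters lie below the block, and the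
  largest letter \<open>N\<close> of the block becomes the root.  The left subtree then belongs to \<open>u\<close> followed by
  larger letters, the right one to a part of the block followed by the smaller letters \<open>v\<close>.
  These are the cases of \<open>over\<close> and \<open>under\<close>.
\<close>

lemma decreasing_tree_insert:
  assumes "distinct (u @ p # v)" "distinct ys" "ys \<noteq> []"
    and "strict_mono_on (set u \<union> set v) f" "strict_mono_on (set ys) g"
    and "\<And>x y. \<lbrakk>x \<in> set u \<union> set v; y \<in> set ys; x < p\<rbrakk> \<Longrightarrow> f x < g y"
    and "\<And>x y. \<lbrakk>x \<in> set u \<union> set v; y \<in> set ys; p < x\<rbrakk> \<Longrightarrow> g y < f x"
  shows "decreasing_tree (map f u @ map g ys @ map f v) =
    tree_insert (Suc (length u)) (decreasing_tree (u @ p # v)) (decreasing_tree ys)"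
  using assms
proof (induction "length u + length v" arbitrary: u v rule: less_induct)
  case less
  note d = less.prems(1) and f = less.prems(4) and g = less.prems(5)
    and below = less.prems(6) and above = less.prems(7)
  have f_sub: "strict_mono_on S f" if "S \<subseteq> set u \<union> set v" for S
    by (rule monotone_on_subset[OF f that])
  have g_sub: "strict_mono_on S g" if "S \<subseteq> set ys" for S
    by (rule monotone_on_subset[OF g that])
  have inj_f: "inj_on f (set u \<union> set v)" and inj_g: "inj_on g (set ys)"
    using f g by (simp_all add: strict_mono_on_imp_inj_on)
  have sep: "f x \<noteq> g y" if "x \<in> set u \<union> set v" "y \<in> set ys" for x y
  proof -
    have "x \<noteq> p"
      using d that by auto
    then show ?thesis
      using below[OF that] above[OF that] by (metis less_irrefl linorder_neqE_nat)
  qed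
  have "f ` set u \<inter> f ` set v = {}"
    using inj_f d by (auto dest: inj_onD)
  moreover have "f ` set u \<inter> g ` set ys = {}" "g ` set ys \<inter> f ` set v = {}"
    using sep by (auto simp: eq_commute)
  moreover have "inj_on f (set u)" "inj_on f (set v)"
    using inj_f by (auto intro: inj_on_subset)
  ultimately have dist: "distinct (map f u @ map g ys @ map f v)"
    using d less.prems(2) inj_g by (auto simp: distinct_map)
  have size_u: "size (decreasing_tree w) = length w" if "distinct w" for w
    using that by (rule size_decreasing_tree)
  obtain a M b where aMb: "u @ p # v = a @ M # b" and M: "\<And>x. x \<in> set a \<union> set b \<Longrightarrow> x < M"
    by (rule split_at_max[OF d]) (simp, blast)
  have tree: "decreasing_tree (u @ p # v) = Graft (decreasing_tree a) (decreasing_tree b)"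
    using d M unfolding aMb by (rule decreasing_tree_append)
  have da: "distinct a" "distinct b"
    using d unfolding aMb by auto
  consider (left) u2 where "u = a @ M # u2" "b = u2 @ p # v"
    | (mid) "a = u" "M = p" "b = v"
    | (right) v1 where "a = u @ p # v1" "v = v1 @ M # b"
    using aMb by (auto simp: append_eq_append_conv2 Cons_eq_append_conv append_eq_Cons_conv)
  then show ?case
  proof cases
    case left
    have IH: "decreasing_tree (map f u2 @ map g ys @ map f v) =
        tree_insert (Suc (length u2)) (decreasing_tree (u2 @ p # v)) (decreasing_tree ys)"
      by (rule less.hyps) (use left d less.prems(2,3) g below above in \<open>auto intro!: f_sub\<close>)
    have "decreasing_tree (map f a @ f M # (map f u2 @ map g ys @ map f v)) =
        Graft (decreasing_tree (map f a)) (decreasing_tree (map f u2 @ map g ys @ map f v))"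
    proof (rule decreasing_tree_append)
      show "distinct (map f a @ f M # map f u2 @ map g ys @ map f v)"
        using dist left by simp
      have "p < M"
        using M left by simp
      then show "x < f M" if "x \<in> set (map f a) \<union> set (map f u2 @ map g ys @ map f v)" for x
        using that M above[of M] strict_mono_onD[OF f] left by auto
    qed
    moreover have "decreasing_tree (map f a) = decreasing_tree a"
      using left by (intro decreasing_tree_map f_sub) auto
    ultimately show ?thesis
      using IH tree left da by (simp add: Let_def size_u)
  next
    case right
    have IH: "decreasing_tree (map f u @ map g ys @ map f v1) =
        tree_insert (Suc (length u)) (decreasing_tree (u @ p # v1)) (decreasing_tree ys)"
      by (rule less.hyps) (use right d less.prems(2,3) g below above in \<open>auto intro!: f_sub\<close>)
    have "decreasing_tree ((map f u @ map g ys @ map f v1) @ f M # map f b) =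
        Graft (decreasing_tree (map f u @ map g ys @ map f v1)) (decreasing_tree (map f b))"
    proof (rule decreasing_tree_append)
      show "distinct ((map f u @ map g ys @ map f v1) @ f M # map f b)"
        using dist right by simp
      have "p < M"
        using M right by simp
      then show "x < f M" if "x \<in> set (map f u @ map g ys @ map f v1) \<union> set (map f b)" for x
        using that M above[of M] strict_mono_onD[OF f] right by auto
    qed
    moreover have "decreasing_tree (map f b) = decreasing_tree b"
      using right by (intro decreasing_tree_map f_sub) auto
    ultimately show ?thesis
      using IH tree right da by (simp add: Let_def size_u)
  next
    case mid
    obtain y1 N y2 where ys: "ys = y1 @ N # y2" and N: "\<And>y. y \<in> set y1 \<union> set y2 \<Longrightarrow> y < N"
      using split_at_max[OF less.prems(2,3)] by metis
    have "decreasing_tree ((map f u @ map g y1) @ g N # (map g y2 @ map f v)) =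
        Graft (decreasing_tree (map f u @ map g y1)) (decreasing_tree (map g y2 @ map f v))"
    proof (rule decreasing_tree_append)
      show "distinct ((map f u @ map g y1) @ g N # map g y2 @ map f v)"
        using dist ys by simp
      show "x < g N" if "x \<in> set (map f u @ map g y1) \<union> set (map g y2 @ map f v)" for x
        using that M N below[of _ N] strict_mono_onD[OF g] mid ys by auto
    qed
    moreover have "decreasing_tree (map f u @ map g y1) =
        over (decreasing_tree (map f u)) (decreasing_tree (map g y1))"
      by (rule decreasing_tree_over) (use dist below M mid ys in auto)
    moreover have "decreasing_tree (map g y2 @ map f v) =
        under (decreasing_tree (map g y2)) (decreasing_tree (map f v))"
      by (rule decreasing_tree_under) (use dist below M mid ys in auto)
    moreover have "decreasing_tree (map f u) = decreasing_tree u"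
      "decreasing_tree (map f v) = decreasing_tree v"
      by (intro decreasing_tree_map f_sub; simp)+
    moreover have "decreasing_tree (map g y1) = decreasing_tree y1"
      "decreasing_tree (map g y2) = decreasing_tree y2"
      using ys by (intro decreasing_tree_map g_sub; auto)+
    moreover have "decreasing_tree ys = Graft (decreasing_tree y1) (decreasing_tree y2)"
      using less.prems(2) N unfolding ys by (rule decreasing_tree_append)
    ultimately show ?thesis
      using tree mid ys da by (simp add: Let_def size_u)
  qed
qed

section \<open>The morphism from permutations to trees\<close>

lemma perm_tree_perm_insert:
  assumes m: "m \<ge> 1" and i: "1 \<le> i" "i \<le> n" and \<sigma>: "\<sigma> \<in> perms n" and \<tau>: "\<tau> \<in> perms m"
  shows "perm_tree (perm_insert i \<sigma> \<tau>) = tree_insert i (perm_tree \<sigma>) (perm_tree \<tau>)"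
proof -
  obtain u p v where upv: "\<sigma> = u @ p # v" "i = Suc (length u)" "p \<ge> 1" "p \<le> n"
    and uv: "set u \<union> set v = {1..n} - {p}"
    by (rule perms_split[OF \<sigma> i])
  have \<tau>_range: "y \<ge> 1" "y \<le> m" if "y \<in> set \<tau>" for y
    using \<tau> that by (auto simp: perms_iff)
  have "decreasing_tree (map (stretch p m) u @ map (\<lambda>q. q + p - 1) \<tau> @ map (stretch p m) v) =
      tree_insert (Suc (length u)) (decreasing_tree (u @ p # v)) (decreasing_tree \<tau>)"
  proof (rule decreasing_tree_insert)
    show "distinct (u @ p # v)" "distinct \<tau>"
      using \<sigma> \<tau> upv(1) by (simp_all add: perms_iff)
    show "\<tau> \<noteq> []"
      using perms_length[OF \<tau>] m by auto
    show "strict_mono_on (set u \<union> set v) (stretch p m)"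
      unfolding uv by (rule strict_mono_onI) (use m in \<open>auto simp: stretch_def\<close>)
    show "strict_mono_on (set \<tau>) (\<lambda>q. q + p - 1)"
      using upv(3) by (intro strict_mono_onI) auto
    show "stretch p m x < y + p - 1" if "x \<in> set u \<union> set v" "y \<in> set \<tau>" "x < p" for x y
      using that \<tau>_range[of y] by (simp add: stretch_def)
    show "y + p - 1 < stretch p m x" if "x \<in> set u \<union> set v" "y \<in> set \<tau>" "p < x" for x y
      using that \<tau>_range[of y] by (simp add: stretch_def)
  qed
  then have "decreasing_tree (perm_insert i \<sigma> \<tau>) =
      tree_insert i (decreasing_tree \<sigma>) (decreasing_tree \<tau>)"
    using perm_insert_append[OF upv(2)] perms_length[OF \<tau>] upv(1,2) by simp
  then show ?thesis
    using decreasing_tree_perm[OF \<sigma>] decreasing_tree_perm[OF \<tau>]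
      decreasing_tree_perm[OF perm_insert_closed[OF assms]] by simp
qed

lemma perm_tree_closed: "\<sigma> \<in> perms n \<Longrightarrow> perm_tree \<sigma> \<in> trees n"
  using size_decreasing_tree[of \<sigma>] decreasing_tree_perm[of \<sigma> n] perms_length[of \<sigma> n]
  by (simp add: trees_def perms_iff)

text \<open>
  A permutation with tree \<open>Graft l r\<close> is obtained from permutations for \<open>l\<close> and \<open>r\<close> by raising the
  second one above the first and writing a new largest letter between them.
\<close>

lemma perm_tree_surj: "trees n \<subseteq> perm_tree ` perms n"
proof -
  have "\<exists>\<sigma>\<in>perms (size t). perm_tree \<sigma> = t" for t
  proof (induction t)
    case Leaf
    show ?case
      by (intro bexI[of _ "[]"]) (simp_all add: perms_iff perm_tree.simps)
  next
    case (Graft l r)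
    then obtain \<sigma> \<tau> where \<sigma>: "\<sigma> \<in> perms (size l)" "perm_tree \<sigma> = l"
      and \<tau>: "\<tau> \<in> perms (size r)" "perm_tree \<tau> = r"
      by blast
    let ?k = "size l" and ?n = "size l + size r + 1"
    let ?\<rho> = "\<sigma> @ ?n # map (\<lambda>x. x + ?k) \<tau>"
    have "set ?\<rho> = {1..?k} \<union> {?n} \<union> (\<lambda>x. x + ?k) ` {1..size r}"
      using \<sigma>(1) \<tau>(1) by (simp add: perms_iff)
    also have "\<dots> = {1..?n}"
      unfolding image_add_atLeastAtMost' by auto
    finally have \<rho>: "?\<rho> \<in> perms ?n"
      by (rule permsI) (simp add: perms_length[OF \<sigma>(1)] perms_length[OF \<tau>(1)])
    have "perm_tree ?\<rho> = decreasing_tree ?\<rho>"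
      using decreasing_tree_perm[OF \<rho>] by simp
    also have "\<dots> = Graft (decreasing_tree \<sigma>) (decreasing_tree (map (\<lambda>x. x + ?k) \<tau>))"
      by (rule decreasing_tree_append) (use \<rho> \<sigma>(1) \<tau>(1) in \<open>auto simp: perms_iff\<close>)
    also have "decreasing_tree (map (\<lambda>x. x + ?k) \<tau>) = decreasing_tree \<tau>"
      by (rule decreasing_tree_map) (auto simp: strict_mono_on_def)
    finally have "perm_tree ?\<rho> = Graft l r"
      using \<sigma>(2) \<tau>(2) decreasing_tree_perm[OF \<sigma>(1)] decreasing_tree_perm[OF \<tau>(1)] by simp
    with \<rho> show ?case
      by (intro bexI[of _ ?\<rho>]) simp_all
  qed
  then show ?thesis
    unfolding trees_def by (intro subsetI) (auto simp: image_iff eq_commute)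
qed

lemma perms_ns_set_operad: "ns_set_operad perms perm_insert [1]"
proof (rule ns_set_operad.intro)
  show "[1] \<in> perms 1"
    by (simp add: perms_iff)
qed (rule perm_insert_closed perm_insert_parallel perm_insert_sequential perm_insert_unit_right
    perm_insert_unit_left; simp only:)+

lemma perm_tree_one: "perm_tree [1] = Graft Leaf Leaf"
proof -
  have "perm_tree [1] = decreasing_tree ([] @ 1 # [])"
    using decreasing_tree_perm[of "[1]" 1] by (simp add: perms_iff)
  also have "\<dots> = Graft Leaf Leaf"
    by (subst decreasing_tree_append) simp_all
  finally show ?thesis .
qed

lemma trees_ns_set_operad: "ns_set_operad trees tree_insert (Graft Leaf Leaf)"
  unfolding perm_tree_one[symmetric]
  by (rule ns_set_operad.surjective_image[OF perms_ns_set_operad])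
    (fact perm_tree_closed perm_tree_surj perm_tree_perm_insert)+

lemma perm_tree_ns_set_operad_morphism:
  "ns_set_operad_morphism perms perm_insert [1] trees tree_insert (Graft Leaf Leaf) perm_tree"
proof (intro ns_set_operad_morphism.intro[OF perms_ns_set_operad trees_ns_set_operad]
    ns_set_operad_morphism_axioms.intro)
  show "perm_tree \<sigma> \<in> trees n" if "\<sigma> \<in> perms n" for n \<sigma>
    by (rule perm_tree_closed[OF that])
qed (fact perm_tree_perm_insert perm_tree_one)+

theorem proposition4p2:
  fixes R :: "('r, 'm) ring_scheme"
  assumes "cring R"
  shows "(\<forall>n m i s t. 1 \<le> i \<and> i \<le> n \<and> 1 \<le> m \<and> s \<in> trees n \<and> t \<in> trees m \<longrightarrow>
            Y_comp R n m i (basis_vec R s) (basis_vec R t) = basis_vec R (tree_insert i s t))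
    \<and> ns_operad R (Y_op R) (Y_comp R) (Y_unit R)
    \<and> (\<forall>n \<sigma>. 1 \<le> n \<and> \<sigma> \<in> perms n \<longrightarrow>
            Lambda R n (basis_vec R \<sigma>) = basis_vec R (perm_tree \<sigma>))
    \<and> ns_operad_morphism R (A_op R) (A_comp R) (A_unit R) (Y_op R) (Y_comp R) (Y_unit R) (Lambda R)
    \<and> (\<forall>n\<ge>1. Lambda R n ` carrier (A_op R n) = carrier (Y_op R n))"
proof -
  interpret R: cring R by (rule assms)
  have A: "A_op R = (\<lambda>n. free_module R (perms n))" "A_comp R = (\<lambda>n m i. bilinear_ext R (perm_insert i))"
    by (simp_all add: fun_eq_iff A_op_def A_comp_def)
  have Y: "Y_op R = (\<lambda>n. free_module R (trees n))" "Y_comp R = (\<lambda>n m i. bilinear_ext R (tree_insert i))"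
    by (simp_all add: fun_eq_iff Y_op_def Y_comp_def)
  have L: "Lambda R = (\<lambda>n. linear_ext R perm_tree)"
    by (simp add: fun_eq_iff Lambda_def)
  have "ns_operad R (Y_op R) (Y_comp R) (Y_unit R)"
    unfolding Y Y_unit_def by (rule ns_set_operad.linearization[OF trees_ns_set_operad assms])
  moreover have "ns_operad_morphism R (A_op R) (A_comp R) (A_unit R) (Y_op R) (Y_comp R) (Y_unit R)
      (Lambda R)"
    unfolding A A_unit_def Y Y_unit_def L
    by (rule ns_set_operad_morphism.linearization[OF perm_tree_ns_set_operad_morphism assms])
  moreover have "Lambda R n ` carrier (A_op R n) = carrier (Y_op R n)" for n
    unfolding A Y L by (rule R.linear_ext_surj) (fact perm_tree_closed perm_tree_surj)+
  ultimately show ?thesis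
    by (simp add: Y L R.bilinear_ext_basis_vec R.linear_ext_basis_vec)
qed

end
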